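(* Let Assumptions A and B hold and run the algorithm with restriction $r=\sigma^{\mathrm{ASY}}\mathbf 1$, i.e. with $\sum_{i=1}^N y_i^0=b-\sigma^{\mathrm{ASY}}\mathbf 1$ (and $M$ sufficiently large so that the allocation sequence converges). Let $(y_1^t,\dots,y_N^t)\to(y_1^\infty,\dots,y_N^\infty)$, and for each $i$ let $(\rho_i^\infty,\xi_i^\infty,x_i^\infty)$ be a lex-optimal solution of (P3) with $y_i^t$ replaced by $y_i^\infty$. Then $(x_1^\infty,\dots,x_N^\infty)$ is feasible for the MILP: $x_i^\infty\in X_i$ for all $i$ and $\sum_{i=1}^N A_i x_i^\infty\preceq b$.
   Context: Data: for each $i\in\{1,\dots,N\}$, $c_i\in\mathbb{R}^{n_i}$, $A_i\in\mathbb{R}^{S\times n_i}$ (rows $A_i^s$), nonempty compact $X_i=\{x_i\in\mathbb{Z}^{Z_i}\times\mathbb{R}^{R_i}:D_ix_i\preceq d_i\}$; $b\in\mathbb{R}^S$. $\preceq$ is componentwise, $\mathbf 1$ the all-ones vector. MILP: minimize $\sum_i c_i^\top x_i$ s.t. $\sum_i A_ix_i\preceq b$, $x_i\in X_i$ (assumed feasible). Restricted LP (LP$_r$) for $r\succeq 0$: minimize $\sum_i c_i^\top z_i$ s.t. $\sum_iA_iz_i\preceq b-r$, $z_i\in\mathrm{conv}(X_i)$. Assumption A: (LP$_r$) (with the restriction $r$ used) is feasible with unique optimal solution. Assumption B: step-sizes $\alpha^t\ge0$ with $\sum_t\alpha^t=\infty$, $\sum_t(\alpha^t)^2<\infty$.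 Restriction: $L_i^s=\min_{x_i\in X_i}A_i^sx_i$, $L_i=(L_i^1,\dots,L_i^S)$; $(x_i^L,\tilde\ell_i)$ an optimal solution of minimize $\ell_i$ over $x_i\in X_i,\ell_i\in\mathbb{R}$ s.t. $A_ix_i-L_i\preceq\ell_i\mathbf 1$; $\sigma^{\mathrm{ASY}}=(S+1)\max_{i}\max_{s}(A_i^sx_i^L-L_i^s)$. Algorithm over a connected undirected graph with neighbor sets $\mathcal N_i$, parameter $M>0$, initialization $\sum_iy_i^0=b-r$. At each $t$, agent $i$: (P1) computes a primal-dual optimal pair $((z_i^t,v_i^t),\mu_i^t)$ of: minimize $c_i^\top z_i+Mv_i$ over $z_i\in\mathrm{conv}(X_i)$, $v_i\ge0$, s.t. $A_iz_i\preceq y_i^t+v_i\mathbf 1$ ($\mu_i^t$ the multiplier of this constraint); (P2) $y_i^{t+1}=y_i^t+\alpha^t\sum_{j\in\mathcal N_i}(\mu_i^t-\mu_j^t)$; (P3) computes $x_i^t$ via the lexicographic problem: minimize lexicographically $(\rho_i,\xi_i)$ over $x_i\in X_i$, $\rho_i\ge0$, $\xi_i$, s.t. $c_i^\top x_i\le\xi_i$, $A_ix_i\preceq y_i^t+\rho_i\mathbf 1$. Equivalently: first $\rho_i^t$ is the minimal $\rho_i\ge0$ such that some $x_i\in X_i$ has $A_ix_i\preceq y_i^t+\rho_i\mathbf 1$; then $x_i^t$ minimizes $c_i^\top x_i$ over $x_i\in X_i$ with $A_ix_i\preceq y_i^t+\rho_i^t\mathbf 1$. *)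

theory Defs
  imports "HOL-Analysis.Analysis"
begin

text \<open>Conventions. Agents are indexed by i in {..<N}, coupling constraints by s in {..<S}.
 A vector in R^n is represented as a function nat => real that vanishes outside {..<n}.
 A matrix with rows indexed by s and columns by j is a function nat => nat => real,
 entry (s,j) = A s j. Vectors in R^S are functions nat => real, only components s < S matter.\<close>

definition rowdot :: "nat \<Rightarrow> (nat \<Rightarrow> real) \<Rightarrow> (nat \<Rightarrow> real) \<Rightarrow> real" where
  "rowdot n a x = (\<Sum>j<n. a j * x j)"

text \<open>Mixed-integer polyhedral set
 {x in Z^Zi x R^(n-Zi) : D x <= d}, where D has m rows.\<close>
definition milp_set :: "nat \<Rightarrow> nat \<Rightarrow> nat \<Rightarrow> (nat \<Rightarrow> nat \<Rightarrow> real) \<Rightarrow> (nat \<Rightarrow> real)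
    \<Rightarrow> (nat \<Rightarrow> real) set" where
  "milp_set n Zi m D d = {x. (\<forall>j\<ge>n. x j = 0) \<and> (\<forall>j<Zi. x j \<in> \<int>)
       \<and> (\<forall>k<m. rowdot n (D k) x \<le> d k)}"

text \<open>Convex hull (set of all finite convex combinations).\<close>
definition conv :: "(nat \<Rightarrow> real) set \<Rightarrow> (nat \<Rightarrow> real) set" where
  "conv X = {x. \<exists>F w. finite F \<and> F \<noteq> {} \<and> F \<subseteq> X \<and> (\<forall>p\<in>F. w p \<ge> 0) \<and> sum w F = 1
               \<and> x = (\<lambda>j. \<Sum>p\<in>F. w p * p j)}"

text \<open>Connected undirected graph on {..<N} with neighbour sets Nb i.\<close>
definition connected_graph :: "nat \<Rightarrow> (nat \<Rightarrow> nat set) \<Rightarrow> bool" where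
  "connected_graph N Nb \<longleftrightarrow>
     (\<forall>i<N. Nb i \<subseteq> {..<N} \<and> i \<notin> Nb i) \<and>
     (\<forall>i<N. \<forall>j<N. j \<in> Nb i \<longleftrightarrow> i \<in> Nb j) \<and>
     (\<forall>i<N. \<forall>j<N. (i, j) \<in> {(a, b). a < N \<and> b < N \<and> b \<in> Nb a}\<^sup>*)"

text \<open>Restricted LP (LP_r), with restriction vector r.\<close>
definition LPr_feasible :: "nat \<Rightarrow> nat \<Rightarrow> (nat \<Rightarrow> nat) \<Rightarrow> (nat \<Rightarrow> nat \<Rightarrow> nat \<Rightarrow> real)
    \<Rightarrow> (nat \<Rightarrow> (nat \<Rightarrow> real) set) \<Rightarrow> (nat \<Rightarrow> real) \<Rightarrow> (nat \<Rightarrow> real)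
    \<Rightarrow> (nat \<Rightarrow> nat \<Rightarrow> real) \<Rightarrow> bool" where
  "LPr_feasible N S n A X b r z \<longleftrightarrow>
     (\<forall>i<N. z i \<in> conv (X i)) \<and>
     (\<forall>s<S. (\<Sum>i<N. rowdot (n i) (A i s) (z i)) \<le> b s - r s)"

definition LPr_optimal :: "nat \<Rightarrow> nat \<Rightarrow> (nat \<Rightarrow> nat) \<Rightarrow> (nat \<Rightarrow> nat \<Rightarrow> real)
    \<Rightarrow> (nat \<Rightarrow> nat \<Rightarrow> nat \<Rightarrow> real)
    \<Rightarrow> (nat \<Rightarrow> (nat \<Rightarrow> real) set) \<Rightarrow> (nat \<Rightarrow> real) \<Rightarrow> (nat \<Rightarrow> real)
    \<Rightarrow> (nat \<Rightarrow> nat \<Rightarrow> real) \<Rightarrow> bool" where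
  "LPr_optimal N S n c A X b r z \<longleftrightarrow> LPr_feasible N S n A X b r z \<and>
     (\<forall>z'. LPr_feasible N S n A X b r z' \<longrightarrow>
        (\<Sum>i<N. rowdot (n i) (c i) (z i)) \<le> (\<Sum>i<N. rowdot (n i) (c i) (z' i)))"

text \<open>Assumption A: (LP_r) feasible with a unique optimal solution (uniqueness up to the
 representation, i.e. of the tuple (z_1,...,z_N)).\<close>
definition assumption_A where
  "assumption_A N S n c A X b r \<longleftrightarrow>
     (\<exists>z. LPr_optimal N S n c A X b r z) \<and>
     (\<forall>z z'. LPr_optimal N S n c A X b r z \<longrightarrow> LPr_optimal N S n c A X b r z'
        \<longrightarrow> (\<forall>i<N. z i = z' i))"

text \<open>Assumption B on step sizes.\<close>
definition assumption_B :: "(nat \<Rightarrow> real) \<Rightarrow> bool" where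
  "assumption_B \<alpha> \<longleftrightarrow> (\<forall>t. \<alpha> t \<ge> 0) \<and> \<not> summable \<alpha> \<and> summable (\<lambda>t. (\<alpha> t)\<^sup>2)"

text \<open>Local LP (P1): minimize c^T z + M v over z in conv X, v >= 0, A z <= y + v 1.\<close>
definition P1_feasible where
  "P1_feasible S n A X y z (v::real) \<longleftrightarrow> z \<in> conv X \<and> v \<ge> 0 \<and>
     (\<forall>s<S. rowdot n (A s) z \<le> y s + v)"

definition P1_primal_optimal where
  "P1_primal_optimal S n c M A X y z v \<longleftrightarrow> P1_feasible S n A X y z v \<and>
     (\<forall>z' v'. P1_feasible S n A X y z' v' \<longrightarrow>
        rowdot n c z + M * v \<le> rowdot n c z' + M * v')"

text \<open>Lagrangian dual function of (P1) w.r.t. the constraint A z <= y + v 1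
 (extended-real valued, may be -infinity).\<close>
definition P1_dual_fun where
  "P1_dual_fun S n c M A X y (\<mu>::nat \<Rightarrow> real) =
     (INF p\<in>{(z, v). z \<in> conv X \<and> (v::real) \<ge> 0}.
        ereal (rowdot n c (fst p) + M * snd p
               + (\<Sum>s<S. \<mu> s * (rowdot n (A s) (fst p) - y s - snd p))))"

definition P1_dual_optimal where
  "P1_dual_optimal S n c M A X y \<mu> \<longleftrightarrow> (\<forall>s<S. \<mu> s \<ge> 0) \<and>
     (\<forall>\<mu>'. (\<forall>s<S. \<mu>' s \<ge> 0) \<longrightarrow> P1_dual_fun S n c M A X y \<mu>' \<le> P1_dual_fun S n c M A X y \<mu>)"

text \<open>Lexicographic problem (P3): lex-minimize (rho, xi) over x in X, rho >= 0, xi,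
 s.t. c^T x <= xi, A x <= y + rho 1.\<close>
definition P3_feasible where
  "P3_feasible S n c A X y (\<rho>::real) (\<xi>::real) x \<longleftrightarrow> x \<in> X \<and> \<rho> \<ge> 0 \<and>
     rowdot n c x \<le> \<xi> \<and> (\<forall>s<S. rowdot n (A s) x \<le> y s + \<rho>)"

definition P3_lex_optimal where
  "P3_lex_optimal S n c A X y \<rho> \<xi> x \<longleftrightarrow> P3_feasible S n c A X y \<rho> \<xi> x \<and>
     (\<forall>\<rho>' \<xi>' x'. P3_feasible S n c A X y \<rho>' \<xi>' x' \<longrightarrow> \<rho> < \<rho>' \<or> (\<rho> = \<rho>' \<and> \<xi> \<le> \<xi>'))"

text \<open>Restriction sigma^ASY.\<close>
definition Lbound where
  "Lbound n A X s = (INF x\<in>X. rowdot n (A s) x)"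

definition xL_optimal where
  "xL_optimal S n A X xL (lv::real) \<longleftrightarrow>
     xL \<in> X \<and> (\<forall>s<S. rowdot n (A s) xL - Lbound n A X s \<le> lv) \<and>
     (\<forall>x' lv'. x' \<in> X \<and> (\<forall>s<S. rowdot n (A s) x' - Lbound n A X s \<le> lv') \<longrightarrow> lv \<le> lv')"

definition sigma_ASY where
  "sigma_ASY N S n A X xL = real (S + 1) *
     Max ((\<lambda>(i, s). rowdot (n i) (A i s) (xL i) - Lbound (n i) (A i) (X i) s) ` ({..<N} \<times> {..<S}))"

end

theory Submission
  imports Defs
begin

text \<open>The limit allocation is optimal for the primal decomposition of the restricted LP, because the
  allocation updates are subgradient steps through the graph Laplacian. For M above an l1 bound on
  the multipliers of the restricted LP no violation is paid in the limit, so the limit allocation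
  carries a solution z of the restricted LP with A i (z i) below the allocation of agent i.
  By uniqueness z is a vertex, hence at most S blocks z i are outside X i. Only those agents may
  violate their allocation in (P3), each by at most sigma / (S + 1), which the restriction absorbs.
  Multipliers exist without a Slater condition because conv (X i) is a polytope.\<close>

section \<open>Bounded polyhedra are generated by finitely many points\<close>

text \<open>Only the allocations are assumed to converge. The multipliers and the local solutions
  need have no limit, so the pairing of the multipliers with a direction can be controlled only at
  arbitrarily late times, not at all late times. This yields, for every tolerance, a tuple that is
  nearly optimal and nearly within the limit allocation. No limit of these tuples is taken: a system
  of linear inequalities over polytopes that is solvable up to every positive error is solvable
  exactly. One duality theorem, \<open>conv_duality\<close>, provides this fact, the multipliers of
  (P1), and the penalty constant K of the restricted LP. As K depends on the restricted LP alone,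
  the threshold \<open>K + 1\<close> for M is fixed before the step sizes and the run are
  chosen.\<close>

definition dot :: "'a set \<Rightarrow> ('a \<Rightarrow> real) \<Rightarrow> ('a \<Rightarrow> real) \<Rightarrow> real" where
  "dot J a x = (\<Sum>j\<in>J. a j * x j)"

definition weights :: "'p set \<Rightarrow> ('p \<Rightarrow> real) \<Rightarrow> bool" where
  "weights V w \<longleftrightarrow> (\<forall>p\<in>V. 0 \<le> w p) \<and> sum w V = 1"

definition fin_hull :: "('a \<Rightarrow> real) set \<Rightarrow> ('a \<Rightarrow> real) set" where
  "fin_hull V = {x. \<exists>w. weights V w \<and> x = (\<lambda>j. \<Sum>p\<in>V. w p * p j)}"

text \<open>Coordinates outside J are pinned to 0, so that functions represent the vectors of R^J
  uniquely. The index type is free: J is the set of coordinates of one agent in one use and a set of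
  pairs (block, generator) in the other.\<close>

definition poly_set :: "'a set \<Rightarrow> (('a \<Rightarrow> real) \<times> real) set \<Rightarrow> ('a \<Rightarrow> real) set" where
  "poly_set J C = {x. (\<forall>j. j \<notin> J \<longrightarrow> x j = 0) \<and> (\<forall>(a, b)\<in>C. dot J a x \<le> b)}"

definition bounded_on :: "'a set \<Rightarrow> ('a \<Rightarrow> real) set \<Rightarrow> bool" where
  "bounded_on J P \<longleftrightarrow> (\<exists>B. \<forall>x\<in>P. \<forall>j\<in>J. \<bar>x j\<bar> \<le> B)"

lemma bounded_on_mono: "bounded_on J P \<Longrightarrow> Q \<subseteq> P \<Longrightarrow> bounded_on J Q"
  unfolding bounded_on_def by blast

lemma dot_add: "dot J a (\<lambda>j. x j + t * y j) = dot J a x + t * dot J a y"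
  unfolding dot_def by (simp add: algebra_simps sum.distrib sum_distrib_left)

lemma dot_comb: "dot J a (\<lambda>j. u * x j + v * y j) = u * dot J a x + v * dot J a y"
  unfolding dot_def by (simp add: algebra_simps sum.distrib sum_distrib_left)

lemma dot_diff: "dot J a (\<lambda>j. x j - y j) = dot J a x - dot J a y"
  unfolding dot_def by (simp add: algebra_simps sum_subtractf)

lemma dot_sum: "dot J a (\<lambda>j. \<Sum>p\<in>V. w p * y p j) = (\<Sum>p\<in>V. w p * dot J a (y p))"
  unfolding dot_def sum_distrib_left
  by (subst sum.swap) (simp add: mult.left_commute)

lemma dot_sum_left: "dot J (\<lambda>j. \<Sum>s\<in>E. m s * a s j) x = (\<Sum>s\<in>E. m s * dot J (a s) x)"
  unfolding dot_def sum_distrib_left sum_distrib_right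
  by (subst sum.swap) (simp add: mult.assoc)

text \<open>Writing the row with membership in T covers both kinds of rows needed later, those of a
  single coordinate and those that sum over a whole block.\<close>

lemma dot_indicator:
  "finite J \<Longrightarrow> T \<subseteq> J \<Longrightarrow> dot J (\<lambda>j. if j \<in> T then k else 0) x = k * (\<Sum>j\<in>T. x j)"
proof -
  assume J: "finite J" "T \<subseteq> J"
  have "dot J (\<lambda>j. if j \<in> T then k else 0) x = (\<Sum>j\<in>J. if j \<in> T then k * x j else 0)"
    unfolding dot_def by (rule sum.cong) auto
  also have "\<dots> = (\<Sum>j\<in>T. k * x j)"
    using J by (simp add: sum.inter_restrict[symmetric] Int_absorb1)
  finally show ?thesis by (simp add: sum_distrib_left)
qed

lemma poly_set_convex:
  assumes "x \<in> poly_set J C" "y \<in> poly_set J C" "0 \<le> u" "0 \<le> v" "u + v = 1"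
  shows "(\<lambda>j. u * x j + v * y j) \<in> poly_set J C"
proof -
  have "u * dot J a x + v * dot J a y \<le> b" if "(a, b) \<in> C" for a b
  proof -
    have "dot J a x \<le> b" "dot J a y \<le> b" using that assms(1,2) by (auto simp: poly_set_def)
    then have "u * dot J a x + v * dot J a y \<le> u * b + v * b"
      using assms(3,4) by (intro add_mono mult_left_mono) auto
    also have "\<dots> = b" using assms(5) by (metis distrib_right mult_1)
    finally show ?thesis .
  qed
  then show ?thesis using assms(1,2) by (auto simp: poly_set_def dot_comb)
qed

lemma weights_comb:
  assumes "weights V w1" "weights V w2" "0 \<le> u" "0 \<le> v" "u + v = 1"
  shows "weights V (\<lambda>p. u * w1 p + v * w2 p)"
  using assms unfolding weights_def
  by (simp add: sum.distrib sum_distrib_left[symmetric])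

lemma fin_hullI: "weights V w \<Longrightarrow> x = (\<lambda>j. \<Sum>p\<in>V. w p * p j) \<Longrightarrow> x \<in> fin_hull V"
  unfolding fin_hull_def by (rule CollectI, rule exI, rule conjI)

lemma fin_hullE:
  assumes "x \<in> fin_hull V"
  obtains w where "weights V w" "x = (\<lambda>j. \<Sum>p\<in>V. w p * p j)"
  using assms unfolding fin_hull_def by (elim CollectE exE conjE)

lemma fin_hull_convex:
  assumes "x \<in> fin_hull V" "y \<in> fin_hull V" "0 \<le> u" "0 \<le> v" "u + v = 1"
  shows "(\<lambda>j. u * x j + v * y j) \<in> fin_hull V"
proof -
  obtain w1 where w1: "weights V w1" "x = (\<lambda>j. \<Sum>p\<in>V. w1 p * p j)"
    using assms(1) by (rule fin_hullE)
  obtain w2 where w2: "weights V w2" "y = (\<lambda>j. \<Sum>p\<in>V. w2 p * p j)"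
    using assms(2) by (rule fin_hullE)
  have "(\<lambda>j. u * x j + v * y j) = (\<lambda>j. \<Sum>p\<in>V. (u * w1 p + v * w2 p) * p j)"
    unfolding w1 w2 by (simp add: sum.distrib sum_distrib_left algebra_simps)
  then show ?thesis by (rule fin_hullI[OF weights_comb[OF w1(1) w2(1) assms(3-5)]])
qed

lemma fin_hull_inc:
  assumes "finite V" "x \<in> V" shows "x \<in> fin_hull V"
proof -
  have "weights V (\<lambda>p. if p = x then 1 else 0)" using assms by (simp add: weights_def)
  moreover have "x = (\<lambda>j. \<Sum>p\<in>V. (if p = x then 1 else 0) * p j)"
  proof
    fix j
    have "(\<Sum>p\<in>V. (if p = x then 1 else 0) * p j) = (\<Sum>p\<in>V. if p = x then x j else 0)"
      by (rule sum.cong) auto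
    then show "x j = (\<Sum>p\<in>V. (if p = x then 1 else 0) * p j)" using assms by simp
  qed
  ultimately show ?thesis by (rule fin_hullI)
qed

definition tight :: "'a set \<Rightarrow> (('a \<Rightarrow> real) \<times> real) set \<Rightarrow> ('a \<Rightarrow> real) \<Rightarrow> (('a \<Rightarrow> real) \<times> real) set" where
  "tight J C x = {(a, b)\<in>C. dot J a x = b}"

text \<open>The ratio test of the simplex method. Tight constraints are constant along d, and
  boundedness forces some other constraint to grow; the smallest ratio is the step at which the
  first of these becomes tight.\<close>

lemma poly_set_move:
  assumes J: "finite J" and C: "finite C" and bdd: "bounded_on J (poly_set J C)"
    and x: "x \<in> poly_set J C" and supp: "\<And>j. j \<notin> J \<Longrightarrow> d j = 0" and nz: "d \<noteq> (\<lambda>_. 0)"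
    and keep: "\<And>a b. (a, b) \<in> tight J C x \<Longrightarrow> dot J a d = 0"
  shows "\<exists>t>0. (\<lambda>j. x j + t * d j) \<in> poly_set J C \<and>
           tight J C x \<subset> tight J C (\<lambda>j. x j + t * d j)"
proof -
  have xle: "dot J a x \<le> b" if "(a, b) \<in> C" for a b using x that by (auto simp: poly_set_def)
  define H where "H = {(a, b)\<in>C. dot J a d > 0}"
  have Hne: "H \<noteq> {}"
  proof
    assume "H = {}"
    then have le: "dot J a d \<le> 0" if "(a, b) \<in> C" for a b
      using that unfolding H_def by force
    have mem: "(\<lambda>j. x j + t * d j) \<in> poly_set J C" if "t \<ge> 0" for t
    proof -
      have "dot J a x + t * dot J a d \<le> b" if "(a, b) \<in> C" for a b
        using xle[OF that] le[OF that] \<open>t \<ge> 0\<close> mult_nonneg_nonpos[of t "dot J a d"] by linarith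
      then show ?thesis using x supp by (auto simp: poly_set_def dot_add)
    qed
    obtain B where B: "\<And>x j. x \<in> poly_set J C \<Longrightarrow> j \<in> J \<Longrightarrow> \<bar>x j\<bar> \<le> B"
      using bdd unfolding bounded_on_def by blast
    obtain j where j: "d j \<noteq> 0" using nz by blast
    then have "j \<in> J" using supp by blast
    \<comment> \<open>If nothing stopped the movement, this step would push coordinate j by
      \<open>B + \<bar>x j\<bar> + 1\<close>, beyond the bound B.\<close>
    define t where "t = (B + \<bar>x j\<bar> + 1) / \<bar>d j\<bar>"
    have B0: "B \<ge> 0" using B[OF x \<open>j \<in> J\<close>] by linarith
    then have "t \<ge> 0" unfolding t_def by simp
    then have "\<bar>x j + t * d j\<bar> \<le> B" using B[OF mem \<open>j \<in> J\<close>] by blast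
    moreover have "\<bar>t * d j\<bar> = B + \<bar>x j\<bar> + 1"
      using j \<open>t \<ge> 0\<close> unfolding abs_mult by (simp add: t_def)
    ultimately show False by linarith
  qed
  have Hfin: "finite H" using C unfolding H_def by (auto intro: finite_subset)
  define r where "r = (\<lambda>(a, b). (b - dot J a x) / dot J a d)"
  define t where "t = Min (r ` H)"
  have "t \<in> r ` H" unfolding t_def using Hfin Hne by simp
  then obtain a0 b0 where ab0: "(a0, b0) \<in> H" "t = (b0 - dot J a0 x) / dot J a0 d"
    unfolding r_def by auto
  have tle: "t \<le> (b - dot J a x) / dot J a d" if "(a, b) \<in> H" for a b
    unfolding t_def using Hfin that by (intro Min_le) (auto simp: r_def image_iff intro!: bexI[of _ "(a, b)"])
  have ab0C: "(a0, b0) \<in> C" "dot J a0 d > 0" using ab0 unfolding H_def by auto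
  then have nt: "(a0, b0) \<notin> tight J C x" using keep by force
  then have "dot J a0 x < b0" using xle[OF ab0C(1)] ab0C(1) unfolding tight_def by force
  then have tpos: "t > 0" using ab0 ab0C by simp
  have "dot J a x + t * dot J a d \<le> b" if "(a, b) \<in> C" for a b
  proof (cases "dot J a d > 0")
    case True
    then have "t \<le> (b - dot J a x) / dot J a d" using tle that unfolding H_def by blast
    then have "t * dot J a d \<le> b - dot J a x" using True by (simp add: pos_le_divide_eq)
    then show ?thesis by linarith
  next
    case False
    then have "t * dot J a d \<le> 0" using tpos by (simp add: mult_nonneg_nonpos)
    then show ?thesis using xle[OF that] by linarith
  qed
  then have mem: "(\<lambda>j. x j + t * d j) \<in> poly_set J C"
    using x supp by (auto simp: poly_set_def dot_add)
  have "tight J C x \<subseteq> tight J C (\<lambda>j. x j + t * d j)"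
    using keep by (force simp: tight_def dot_add)
  moreover have "(a0, b0) \<in> tight J C (\<lambda>j. x j + t * d j)"
    using ab0C unfolding tight_def dot_add ab0(2) by simp
  ultimately show ?thesis using mem tpos nt by blast
qed

text \<open>The generating points are those determined by their tight constraints. Any other point lies
  in the interior of a segment of the polyhedron whose two ends have strictly more tight
  constraints.\<close>

lemma poly_set_finitely_generated:
  assumes J: "finite J" and C: "finite C" and bdd: "bounded_on J (poly_set J C)"
  shows "\<exists>V. finite V \<and> V \<subseteq> poly_set J C \<and> poly_set J C \<subseteq> fin_hull V"
proof -
  let ?P = "poly_set J C"
  define V where "V = {x\<in>?P. \<forall>x'\<in>?P. tight J C x \<subseteq> tight J C x' \<longrightarrow> x' = x}"
  have "inj_on (tight J C) V" unfolding inj_on_def V_def by auto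
  moreover have "tight J C ` V \<subseteq> Pow C" unfolding tight_def by auto
  ultimately have Vfin: "finite V" using C by (meson finite_Pow_iff inj_on_finite)
  have "x \<in> ?P \<Longrightarrow> x \<in> fin_hull V" for x
  proof (induction "card (C - tight J C x)" arbitrary: x rule: less_induct)
    case less
    have smaller: "card (C - tight J C x') < card (C - tight J C x)"
      if "tight J C x \<subset> tight J C x'" for x'
      using that C by (intro psubset_card_mono) (auto simp: tight_def)
    show ?case
    proof (cases "x \<in> V")
      case True
      then show ?thesis using Vfin fin_hull_inc by blast
    next
      case False
      then obtain x' where x': "x' \<in> ?P" "tight J C x \<subseteq> tight J C x'" "x' \<noteq> x"
        using less.prems unfolding V_def by blast
      define d where "d = (\<lambda>j. x' j - x j)"
      have supp: "d j = 0" if "j \<notin> J" for j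
        using that x'(1) less.prems by (simp add: d_def poly_set_def)
      have nz: "d \<noteq> (\<lambda>_. 0)" using x'(3) unfolding d_def by (auto simp: fun_eq_iff)
      have keep: "dot J a d = 0" if "(a, b) \<in> tight J C x" for a b
        using that x'(2) unfolding d_def dot_diff by (auto simp: tight_def)
      obtain t1 where t1: "t1 > 0" "(\<lambda>j. x j + t1 * d j) \<in> ?P"
          "tight J C x \<subset> tight J C (\<lambda>j. x j + t1 * d j)"
        using poly_set_move[OF J C bdd less.prems supp nz] keep by metis
      have keep': "dot J a (\<lambda>j. - d j) = 0" if "(a, b) \<in> tight J C x" for a b
        using keep[OF that] by (simp add: dot_def sum_negf)
      have supp': "- d j = 0" if "j \<notin> J" for j using supp[OF that] by simp
      have nz': "(\<lambda>j. - d j) \<noteq> (\<lambda>_. 0)" using nz by (auto simp: fun_eq_iff)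
      obtain t2 where t2: "t2 > 0" "(\<lambda>j. x j + t2 * - d j) \<in> ?P"
          "tight J C x \<subset> tight J C (\<lambda>j. x j + t2 * - d j)"
        using poly_set_move[OF J C bdd less.prems supp' nz'] keep' by metis
      have h: "(\<lambda>j. x j + t1 * d j) \<in> fin_hull V" "(\<lambda>j. x j + t2 * - d j) \<in> fin_hull V"
        using less.hyps[OF smaller[OF t1(3)] t1(2)] less.hyps[OF smaller[OF t2(3)] t2(2)] by auto
      \<comment> \<open>x divides the segment between its two displaced copies in the ratio t1 : t2,
        so the displacements cancel with these weights.\<close>
      let ?u = "t2 / (t1 + t2)" and ?v = "t1 / (t1 + t2)"
      have "?u + ?v = 1" using t1 t2 by (simp add: add_divide_distrib[symmetric])
      then have "(\<lambda>j. ?u * (x j + t1 * d j) + ?v * (x j + t2 * - d j)) \<in> fin_hull V"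
        using t1(1) t2(1) by (intro fin_hull_convex[OF h]) auto
      moreover have "?u * (x j + t1 * d j) + ?v * (x j + t2 * - d j) = x j" for j
      proof -
        have "?u * (x j + t1 * d j) + ?v * (x j + t2 * - d j) = (?u + ?v) * x j"
          by (simp add: algebra_simps)
        then show ?thesis using \<open>?u + ?v = 1\<close> by simp
      qed
      ultimately show ?thesis by simp
    qed
  qed
  moreover have "V \<subseteq> ?P" unfolding V_def by blast
  ultimately show ?thesis using Vfin by blast
qed

section \<open>Linear programming duality\<close>

text \<open>A generator that violates the constraint demands a multiplier of at least
  \<open>- g p / h p\<close>, and the largest of these finitely many demands is attained. That is
  where finite generation replaces a Slater condition. A generator with slack is compared with a
  maximising p: the segment between them meets the hyperplane h = 0, where the hypothesis applies.
  As g and h are affine, checking the generators suffices.\<close>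

lemma lagrange_single:
  assumes J: "finite J" and C: "finite C" and bdd: "bounded_on J (poly_set J C)"
    and hyp: "\<And>x. x \<in> poly_set J C \<Longrightarrow> dot J a x \<le> b \<Longrightarrow> \<gamma> \<le> dot J f x"
  shows "\<exists>K\<ge>0. \<forall>x\<in>poly_set J C. \<gamma> \<le> dot J f x + K * (dot J a x - b)"
proof -
  obtain V where V: "finite V" "V \<subseteq> poly_set J C" "poly_set J C \<subseteq> fin_hull V"
    using poly_set_finitely_generated[OF J C bdd] by blast
  define g where "g = (\<lambda>x. dot J f x - \<gamma>)"
  define h where "h = (\<lambda>x. dot J a x - b)"
  define K where "K = Max (insert 0 ((\<lambda>p. - g p / h p) ` {p\<in>V. h p > 0}))"
  have K0: "K \<ge> 0" unfolding K_def using V(1) by simp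
  have Kge: "- g p / h p \<le> K" if "p \<in> V" "h p > 0" for p
    unfolding K_def using V(1) that by (intro Max_ge) auto
  have "K \<in> insert 0 ((\<lambda>p. - g p / h p) ` {p\<in>V. h p > 0})"
    unfolding K_def using V(1) by (intro Max_in) auto
  then consider "K = 0" | p where "p \<in> V" "h p > 0" "K = - g p / h p" by auto
  note Kcases = this
  have vert: "0 \<le> g q + K * h q" if q: "q \<in> V" for q
  proof (cases "h q > 0")
    case True
    then have "- g q \<le> K * h q" using Kge[OF q True] True pos_divide_le_eq by blast
    then show ?thesis by linarith
  next
    case False
    then have gq: "g q \<ge> 0" using hyp[of q] q V(2) unfolding g_def h_def by force
    show ?thesis using Kcases
    proof cases
      case 1
      then show ?thesis using gq by simp
    next
      case (2 p)
      define D where "D = h p - h q"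
      have D: "D > 0" using 2 False unfolding D_def by linarith
      \<comment> \<open>These weights solve \<open>u * h q + v * h p = 0\<close> with
        \<open>u + v = 1\<close>, which puts the mixed point exactly on the constraint.\<close>
      define u v where "u = h p / D" and "v = - h q / D"
      have "u + v = 1"
        unfolding u_def v_def add_divide_distrib[symmetric] using D by (simp add: D_def)
      moreover have "u \<ge> 0" "v \<ge> 0"
        unfolding u_def v_def using D 2 False by (auto intro: divide_nonneg_pos divide_nonpos_pos)
      ultimately have uv: "u \<ge> 0" "v \<ge> 0" "u + v = 1" by auto
      then have v: "v = 1 - u" by simp
      define x where "x = (\<lambda>j. u * q j + v * p j)"
      have xP: "x \<in> poly_set J C"
        unfolding x_def using V(2) q 2 uv by (intro poly_set_convex) auto
      have "dot J a x - b = u * h q + v * h p"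
        unfolding x_def dot_comb h_def v by (simp add: algebra_simps)
      also have "\<dots> = 0" unfolding u_def v_def by simp
      finally have "\<gamma> \<le> dot J f x" using hyp[OF xP] by simp
      moreover have "dot J f x - \<gamma> = u * g q + v * g p"
        unfolding x_def dot_comb g_def v by (simp add: algebra_simps)
      ultimately have "0 \<le> u * g q + v * g p" by simp
      also have "\<dots> = (h p * g q - h q * g p) / D"
        unfolding u_def v_def by (simp add: diff_divide_distrib)
      finally have "0 \<le> h p * g q - h q * g p" using D by (simp add: zero_le_divide_iff)
      then have "0 \<le> (h p * g q - h q * g p) / h p" using 2 by simp
      also have "\<dots> = g q + K * h q" unfolding 2(3) using 2(2) by (simp add: diff_divide_distrib)
      finally show ?thesis .
    qed
  qed
  have "\<gamma> \<le> dot J f x + K * (dot J a x - b)" if x: "x \<in> poly_set J C" for x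
  proof -
    obtain w where w: "weights V w" "x = (\<lambda>j. \<Sum>p\<in>V. w p * p j)"
      by (rule fin_hullE[OF subsetD[OF V(3) x]])
    have w1: "sum w V = 1" using w(1) by (simp add: weights_def)
    have "0 \<le> (\<Sum>p\<in>V. w p * (g p + K * h p))"
      using w(1) vert by (intro sum_nonneg mult_nonneg_nonneg) (auto simp: weights_def)
    also have "\<dots> = (\<Sum>p\<in>V. w p * dot J f p) - sum w V * \<gamma>
        + K * ((\<Sum>p\<in>V. w p * dot J a p) - sum w V * b)"
      unfolding g_def h_def
      by (simp add: algebra_simps sum.distrib sum_subtractf sum_distrib_left sum_distrib_right)
    also have "\<dots> = dot J f x - \<gamma> + K * (dot J a x - b)"
      unfolding w(2) dot_sum w1 by simp
    finally show ?thesis by linarith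
  qed
  then show ?thesis using K0 by blast
qed

text \<open>Constraints are priced one at a time. The induction hypothesis is used with constraint e
  still imposed as part of the polyhedron, which is why C is generalised; then e itself is priced by
  \<open>lagrange_single\<close>.\<close>

lemma lagrange_duality:
  assumes J: "finite J" and E: "finite E"
  shows "finite C \<Longrightarrow> bounded_on J (poly_set J C) \<Longrightarrow>
    (\<And>x. x \<in> poly_set J C \<Longrightarrow> \<forall>s\<in>E. dot J (a s) x \<le> b s \<Longrightarrow> \<gamma> \<le> dot J f x) \<Longrightarrow>
    \<exists>\<mu>. (\<forall>s\<in>E. 0 \<le> \<mu> s) \<and>
      (\<forall>x\<in>poly_set J C. \<gamma> \<le> dot J f x + (\<Sum>s\<in>E. \<mu> s * (dot J (a s) x - b s)))"
  using E
proof (induction E arbitrary: C rule: finite_induct)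
  case empty
  then show ?case by simp
next
  case (insert e E)
  let ?C = "insert (a e, b e) C"
  have memC: "x \<in> poly_set J ?C \<longleftrightarrow> x \<in> poly_set J C \<and> dot J (a e) x \<le> b e" for x
    by (auto simp: poly_set_def)
  have "bounded_on J (poly_set J ?C)"
    using insert.prems(2) by (rule bounded_on_mono) (auto simp: memC)
  then obtain \<mu> where \<mu>: "\<forall>s\<in>E. 0 \<le> \<mu> s"
    "\<forall>x\<in>poly_set J ?C. \<gamma> \<le> dot J f x + (\<Sum>s\<in>E. \<mu> s * (dot J (a s) x - b s))"
    using insert.IH[of ?C] insert.prems(1,3) by (auto simp: memC)
  \<comment> \<open>The constraints already priced are absorbed into the objective, up to a
    constant, so that the single-constraint case applies to e.\<close>
  define f' where "f' = (\<lambda>j. f j + (\<Sum>s\<in>E. \<mu> s * a s j))"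
  have f': "dot J f' x = dot J f x + (\<Sum>s\<in>E. \<mu> s * dot J (a s) x)" for x
    unfolding f'_def dot_sum_left[symmetric] by (simp add: dot_def distrib_right sum.distrib)
  have eq: "dot J f x + (\<Sum>s\<in>E. \<mu> s * (dot J (a s) x - b s)) =
      dot J f' x - (\<Sum>s\<in>E. \<mu> s * b s)" for x
    unfolding f' by (simp add: right_diff_distrib sum_subtractf)
  obtain K where K: "K \<ge> 0"
    "\<forall>x\<in>poly_set J C. \<gamma> + (\<Sum>s\<in>E. \<mu> s * b s) \<le> dot J f' x + K * (dot J (a e) x - b e)"
    using lagrange_single[OF J insert.prems(1,2), of "a e" "b e" "\<gamma> + (\<Sum>s\<in>E. \<mu> s * b s)" f']
      \<mu>(2) unfolding eq by (force simp: memC)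
  define \<nu> where "\<nu> = \<mu>(e := K)"
  have nuE: "(\<Sum>s\<in>E. \<nu> s * (dot J (a s) x - b s)) = (\<Sum>s\<in>E. \<mu> s * (dot J (a s) x - b s))" for x
    unfolding \<nu>_def using insert.hyps by (intro sum.cong) auto
  have "\<gamma> \<le> dot J f x + (\<Sum>s\<in>insert e E. \<nu> s * (dot J (a s) x - b s))"
    if "x \<in> poly_set J C" for x
  proof -
    have "(\<Sum>s\<in>insert e E. \<nu> s * (dot J (a s) x - b s)) =
        K * (dot J (a e) x - b e) + (\<Sum>s\<in>E. \<mu> s * (dot J (a s) x - b s))"
      using insert.hyps nuE by (simp add: \<nu>_def)
    then show ?thesis using K(2) that eq[of x] by force
  qed
  moreover have "\<forall>s\<in>insert e E. 0 \<le> \<nu> s" using \<mu>(1) K(1) by (simp add: \<nu>_def)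
  ultimately show ?case by blast
qed

text \<open>The unknowns are the weights themselves, one coordinate for each pair (block,
  generator). A product of simplices is a bounded polyhedron in these coordinates, and the values of
  objective and constraints at the generators become coefficients.\<close>

lemma block_duality:
  assumes I: "finite I" and V: "\<And>i. i \<in> I \<Longrightarrow> finite (V i)" and E: "finite E"
    and hyp: "\<And>w. \<forall>i\<in>I. weights (V i) (w i) \<Longrightarrow>
        \<forall>s\<in>E. (\<Sum>i\<in>I. \<Sum>p\<in>V i. w i p * a s i p) \<le> b s \<Longrightarrow>
        \<gamma> \<le> (\<Sum>i\<in>I. \<Sum>p\<in>V i. w i p * f i p)"
  shows "\<exists>\<mu>. (\<forall>s\<in>E. 0 \<le> \<mu> s) \<and> (\<forall>w. (\<forall>i\<in>I. weights (V i) (w i)) \<longrightarrow>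
     \<gamma> \<le> (\<Sum>i\<in>I. \<Sum>p\<in>V i. w i p * f i p)
        + (\<Sum>s\<in>E. \<mu> s * ((\<Sum>i\<in>I. \<Sum>p\<in>V i. w i p * a s i p) - b s)))"
proof -
  define J where "J = Sigma I V"
  \<comment> \<open>\<open>C1\<close> states that the weights are nonnegative; \<open>C2\<close> and
    \<open>C3\<close> state that each block sums to at most and at least 1.\<close>
  define C1 where "C1 = (\<lambda>j. ((\<lambda>k. if k \<in> {j} then - 1 else (0::real)), 0::real)) ` J"
  define C2 where "C2 = (\<lambda>i. ((\<lambda>k. if k \<in> {i} \<times> V i then 1 else (0::real)), 1::real)) ` I"
  define C3 where "C3 = (\<lambda>i. ((\<lambda>k. if k \<in> {i} \<times> V i then - 1 else (0::real)), - 1::real)) ` I"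
  define C where "C = C1 \<union> C2 \<union> C3"
  have J: "finite J" unfolding J_def using I V by blast
  have C: "finite C" unfolding C_def C1_def C2_def C3_def using I J by blast
  have sub: "{i} \<times> V i \<subseteq> J" if "i \<in> I" for i using that unfolding J_def by auto
  have blk: "(\<Sum>k\<in>{i} \<times> V i. x k) = (\<Sum>p\<in>V i. x (i, p))" for x :: "_ \<Rightarrow> real" and i
    using sum.cartesian_product[of "\<lambda>i p. x (i, p)" "V i" "{i}"] by simp
  have memP: "x \<in> poly_set J C \<longleftrightarrow> (\<forall>j. j \<notin> J \<longrightarrow> x j = 0) \<and> (\<forall>i\<in>I. weights (V i) (\<lambda>p. x (i, p)))" for x
  proof -
    have 1: "(\<forall>(a, b)\<in>C1. dot J a x \<le> b) \<longleftrightarrow> (\<forall>j\<in>J. x j \<ge> 0)"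
    proof -
      have "dot J (\<lambda>k. if k \<in> {j} then - 1 else 0) x = - x j" if "j \<in> J" for j
        using dot_indicator[OF J, of "{j}" "-1" x] that by simp
      then show ?thesis unfolding C1_def by simp
    qed
    have 2: "(\<forall>(a, b)\<in>C2. dot J a x \<le> b) \<longleftrightarrow> (\<forall>i\<in>I. (\<Sum>p\<in>V i. x (i, p)) \<le> 1)"
    proof -
      have "dot J (\<lambda>k. if k \<in> {i} \<times> V i then 1 else 0) x = (\<Sum>p\<in>V i. x (i, p))" if "i \<in> I" for i
        using dot_indicator[OF J sub[OF that], of 1 x] unfolding blk by simp
      then show ?thesis unfolding C2_def by simp
    qed
    have 3: "(\<forall>(a, b)\<in>C3. dot J a x \<le> b) \<longleftrightarrow> (\<forall>i\<in>I. (\<Sum>p\<in>V i. x (i, p)) \<ge> 1)"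
    proof -
      have "dot J (\<lambda>k. if k \<in> {i} \<times> V i then - 1 else 0) x = - (\<Sum>p\<in>V i. x (i, p))" if "i \<in> I" for i
        using dot_indicator[OF J sub[OF that], of "- 1" x] unfolding blk by simp
      then show ?thesis unfolding C3_def by simp
    qed
    have "(\<forall>(a, b)\<in>C. dot J a x \<le> b) \<longleftrightarrow> (\<forall>j\<in>J. x j \<ge> 0) \<and>
        (\<forall>i\<in>I. (\<Sum>p\<in>V i. x (i, p)) \<le> 1) \<and> (\<forall>i\<in>I. (\<Sum>p\<in>V i. x (i, p)) \<ge> 1)"
      unfolding 1[symmetric] 2[symmetric] 3[symmetric] C_def ball_Un by blast
    moreover have "(\<forall>j\<in>J. x j \<ge> 0) \<longleftrightarrow> (\<forall>i\<in>I. \<forall>p\<in>V i. 0 \<le> x (i, p))"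
      unfolding J_def by auto
    moreover have "(\<forall>i\<in>I. weights (V i) (\<lambda>p. x (i, p))) \<longleftrightarrow> (\<forall>i\<in>I. \<forall>p\<in>V i. 0 \<le> x (i, p)) \<and>
        (\<forall>i\<in>I. (\<Sum>p\<in>V i. x (i, p)) \<le> 1) \<and> (\<forall>i\<in>I. (\<Sum>p\<in>V i. x (i, p)) \<ge> 1)"
      unfolding weights_def by (auto simp: order_eq_iff)
    ultimately show ?thesis unfolding poly_set_def by blast
  qed
  have dotJ: "dot J (\<lambda>(i, p). g i p) x = (\<Sum>i\<in>I. \<Sum>p\<in>V i. x (i, p) * g i p)" for g x
    unfolding dot_def J_def using I V
    by (simp add: sum.Sigma split_def mult.commute)
  have bdd: "bounded_on J (poly_set J C)"
    unfolding bounded_on_def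
  proof (intro exI ballI)
    fix x j assume x: "x \<in> poly_set J C" and "j \<in> J"
    then obtain i p where j: "j = (i, p)" "i \<in> I" "p \<in> V i" unfolding J_def by auto
    then have w: "weights (V i) (\<lambda>p. x (i, p))" using x memP by blast
    have "x (i, p) \<le> (\<Sum>p\<in>V i. x (i, p))"
      using w V j by (intro member_le_sum) (auto simp: weights_def)
    then show "\<bar>x j\<bar> \<le> 1" using w j by (auto simp: weights_def)
  qed
  have "\<exists>\<mu>. (\<forall>s\<in>E. 0 \<le> \<mu> s) \<and> (\<forall>x\<in>poly_set J C. \<gamma> \<le> dot J (\<lambda>(i, p). f i p) x
      + (\<Sum>s\<in>E. \<mu> s * (dot J (\<lambda>(i, p). a s i p) x - b s)))"
  proof (rule lagrange_duality[OF J E C bdd])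
    fix x assume "x \<in> poly_set J C" "\<forall>s\<in>E. dot J (\<lambda>(i, p). a s i p) x \<le> b s"
    then show "\<gamma> \<le> dot J (\<lambda>(i, p). f i p) x"
      using hyp[of "\<lambda>i p. x (i, p)"] unfolding dotJ memP by blast
  qed
  then obtain \<mu> where \<mu>: "\<forall>s\<in>E. 0 \<le> \<mu> s"
    "\<forall>x\<in>poly_set J C. \<gamma> \<le> dot J (\<lambda>(i, p). f i p) x
      + (\<Sum>s\<in>E. \<mu> s * (dot J (\<lambda>(i, p). a s i p) x - b s))" by blast
  have "\<gamma> \<le> (\<Sum>i\<in>I. \<Sum>p\<in>V i. w i p * f i p)
        + (\<Sum>s\<in>E. \<mu> s * ((\<Sum>i\<in>I. \<Sum>p\<in>V i. w i p * a s i p) - b s))"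
    if w: "\<forall>i\<in>I. weights (V i) (w i)" for w
  proof -
    \<comment> \<open>The weights are arbitrary off the generators, whereas members of
      \<open>poly_set\<close> must vanish outside J.\<close>
    define x where "x = (\<lambda>(i, p). if (i, p) \<in> J then w i p else 0)"
    have xw: "x (i, p) = w i p" if "i \<in> I" "p \<in> V i" for i p
      using that unfolding x_def J_def by simp
    have "x \<in> poly_set J C"
      unfolding memP using w xw by (auto simp: weights_def x_def)
    moreover have "(\<Sum>i\<in>I. \<Sum>p\<in>V i. x (i, p) * g i p) = (\<Sum>i\<in>I. \<Sum>p\<in>V i. w i p * g i p)" for g
      by (intro sum.cong refl) (simp add: xw)
    ultimately show ?thesis using \<mu>(2) unfolding dotJ by auto
  qed
  then show ?thesis using \<mu>(1) by blast
qed

section \<open>Convex hulls of compact mixed-integer sets\<close>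

lemma rowdot_dot: "rowdot n a x = dot {..<n} a x"
  by (simp add: rowdot_def dot_def)

lemma conv_iff: "x \<in> conv X \<longleftrightarrow> (\<exists>F. finite F \<and> F \<subseteq> X \<and> x \<in> fin_hull F)"
proof
  assume "x \<in> conv X"
  then show "\<exists>F. finite F \<and> F \<subseteq> X \<and> x \<in> fin_hull F"
    unfolding conv_def fin_hull_def weights_def by auto
next
  assume "\<exists>F. finite F \<and> F \<subseteq> X \<and> x \<in> fin_hull F"
  then obtain F where F: "finite F" "F \<subseteq> X" "x \<in> fin_hull F" by auto
  obtain w where w: "weights F w" "x = (\<lambda>j. \<Sum>p\<in>F. w p * p j)"
    using F(3) by (rule fin_hullE)
  have "F \<noteq> {}" using w(1) by (auto simp: weights_def)
  then show "x \<in> conv X"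
    using F w unfolding conv_def weights_def by auto
qed

lemma fin_hull_sum:
  assumes F: "finite F" "weights F w" and y: "\<And>p. p \<in> F \<Longrightarrow> y p \<in> fin_hull V"
  shows "(\<lambda>j. \<Sum>p\<in>F. w p * y p j) \<in> fin_hull V"
proof -
  have "\<exists>u. weights V u \<and> y p = (\<lambda>j. \<Sum>q\<in>V. u q * q j)" if p: "p \<in> F" for p
    by (rule fin_hullE[OF y[OF p]]) (rule exI, rule conjI)
  then obtain u where u: "\<And>p. p \<in> F \<Longrightarrow> weights V (u p)"
      "\<And>p. p \<in> F \<Longrightarrow> y p = (\<lambda>j. \<Sum>q\<in>V. u p q * q j)"
    by metis
  have "weights V (\<lambda>q. \<Sum>p\<in>F. w p * u p q)"
    unfolding weights_def
  proof (intro conjI ballI)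
    show "0 \<le> (\<Sum>p\<in>F. w p * u p q)" if "q \<in> V" for q
      using F u(1) that by (intro sum_nonneg mult_nonneg_nonneg) (auto simp: weights_def)
    have "(\<Sum>q\<in>V. \<Sum>p\<in>F. w p * u p q) = (\<Sum>p\<in>F. w p * sum (u p) V)"
      by (subst sum.swap) (simp add: sum_distrib_left)
    also have "\<dots> = 1" using F u(1) by (simp add: weights_def)
    finally show "(\<Sum>q\<in>V. \<Sum>p\<in>F. w p * u p q) = 1" .
  qed
  moreover have "(\<lambda>j. \<Sum>p\<in>F. w p * y p j) = (\<lambda>j. \<Sum>q\<in>V. (\<Sum>p\<in>F. w p * u p q) * q j)"
  proof
    fix j
    have "(\<Sum>p\<in>F. w p * y p j) = (\<Sum>p\<in>F. \<Sum>q\<in>V. w p * u p q * q j)"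
      by (rule sum.cong) (simp_all add: u(2) sum_distrib_left mult.assoc)
    also have "\<dots> = (\<Sum>q\<in>V. (\<Sum>p\<in>F. w p * u p q) * q j)"
      by (subst sum.swap) (simp add: sum_distrib_right)
    finally show "(\<Sum>p\<in>F. w p * y p j) = (\<Sum>q\<in>V. (\<Sum>p\<in>F. w p * u p q) * q j)" .
  qed
  ultimately show ?thesis by (rule fin_hullI)
qed

lemma fin_hull_subset:
  assumes V: "finite V" "V \<subseteq> fin_hull W" shows "fin_hull V \<subseteq> fin_hull W"
proof
  fix x assume "x \<in> fin_hull V"
  then obtain w where w: "weights V w" "x = (\<lambda>j. \<Sum>p\<in>V. w p * p j)" by (rule fin_hullE)
  show "x \<in> fin_hull W" unfolding w(2) using V by (intro fin_hull_sum[OF V(1) w(1)]) auto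
qed

lemma fin_hull_mono: "finite W \<Longrightarrow> V \<subseteq> W \<Longrightarrow> fin_hull V \<subseteq> fin_hull W"
  by (rule fin_hull_subset) (auto intro: finite_subset fin_hull_inc)

lemma conv_convex:
  assumes "x \<in> conv X" "y \<in> conv X" "0 \<le> u" "0 \<le> v" "u + v = 1"
  shows "(\<lambda>j. u * x j + v * y j) \<in> conv X"
proof -
  obtain F G where F: "finite F" "F \<subseteq> X" "x \<in> fin_hull F" and G: "finite G" "G \<subseteq> X" "y \<in> fin_hull G"
    using assms(1,2) unfolding conv_iff by auto
  have "x \<in> fin_hull (F \<union> G)" "y \<in> fin_hull (F \<union> G)"
    using F G fin_hull_mono[of "F \<union> G" F] fin_hull_mono[of "F \<union> G" G] by auto
  then have "(\<lambda>j. u * x j + v * y j) \<in> fin_hull (F \<union> G)"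
    using assms(3-5) by (rule fin_hull_convex)
  then show ?thesis unfolding conv_iff using F G by (intro exI[of _ "F \<union> G"]) auto
qed

lemma conv_inc: "x \<in> X \<Longrightarrow> x \<in> conv X"
  unfolding conv_iff by (intro exI[of _ "{x}"]) (auto intro: fin_hull_inc)

text \<open>The convex hull is a polytope. This is the form in which compactness and the
  mixed-integer structure of X enter all later arguments.\<close>

definition finitely_generated :: "(nat \<Rightarrow> real) set \<Rightarrow> bool" where
  "finitely_generated X \<longleftrightarrow> (\<exists>V. finite V \<and> conv X = fin_hull V)"

lemma finitely_generatedI:
  assumes V: "finite V" "V \<subseteq> X" "X \<subseteq> fin_hull V"
  shows "finitely_generated X"
proof -
  have "conv X \<subseteq> fin_hull V"
  proof
    fix x assume "x \<in> conv X"
    then obtain F where F: "finite F" "F \<subseteq> X" "x \<in> fin_hull F" unfolding conv_iff by auto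
    then show "x \<in> fin_hull V" using fin_hull_subset[of F V] V by auto
  qed
  moreover have "fin_hull V \<subseteq> conv X" using V by (auto simp: conv_iff)
  ultimately show ?thesis unfolding finitely_generated_def using V(1) by blast
qed

lemma finitely_generated_finite: "finite X \<Longrightarrow> finitely_generated X"
  by (rule finitely_generatedI[of X]) (auto intro: fin_hull_inc)

text \<open>Compactness refers to the product topology on functions, in which every coordinate is
  continuous. The sum of the n separate bounds serves as a common one.\<close>

lemma compact_coordinates_bounded:
  fixes X :: "(nat \<Rightarrow> real) set"
  assumes "compact X"
  shows "\<exists>B. \<forall>x\<in>X. \<forall>j<n. \<bar>x j\<bar> \<le> B"
proof -
  have "\<exists>B. \<forall>x\<in>X. \<bar>x j\<bar> \<le> B" for j
  proof -
    have "continuous_on X (\<lambda>x. x j)"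
      by (rule continuous_on_product_then_coordinatewise[OF continuous_on_id])
    then have "compact ((\<lambda>x. x j) ` X)" using assms compact_continuous_image by blast
    then have "bounded ((\<lambda>x. x j) ` X)" by (rule compact_imp_bounded)
    then show ?thesis unfolding bounded_iff by auto
  qed
  then obtain B where B: "\<And>j x. x \<in> X \<Longrightarrow> \<bar>x j\<bar> \<le> B j" by metis
  have "\<bar>x j\<bar> \<le> (\<Sum>j<n. \<bar>B j\<bar>)" if "x \<in> X" "j < n" for x j
  proof -
    have "\<bar>x j\<bar> \<le> \<bar>B j\<bar>" using B[OF that(1), of j] by linarith
    also have "\<dots> \<le> (\<Sum>j<n. \<bar>B j\<bar>)" using that(2) by (intro member_le_sum) auto
    finally show ?thesis .
  qed
  then show ?thesis by blast
qed

text \<open>Fixing the integer coordinates cuts the set into finitely many bounded polyhedra.\<close>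

lemma milp_set_finitely_generated:
  assumes Zi: "Zi \<le> n" and comp: "compact (milp_set n Zi m D d)"
  shows "finitely_generated (milp_set n Zi m D d)"
proof -
  let ?X = "milp_set n Zi m D d"
  obtain B where B: "\<And>x j. x \<in> ?X \<Longrightarrow> j < n \<Longrightarrow> \<bar>x j\<bar> \<le> B"
    using compact_coordinates_bounded[OF comp, of n] by blast
  \<comment> \<open>The possible integer parts. They are finitely many because each entry is an
    integer in a bounded interval and \<open>PiE\<close> fixes the values outside
    \<open>{..<Zi}\<close>.\<close>
  define K where "K = PiE {..<Zi} (\<lambda>_. {r \<in> \<int>. \<bar>r\<bar> \<le> B})"
  have Kfin: "finite K" unfolding K_def by (intro finite_PiE finite_abs_int_segment) auto
  define C where "C k = (\<lambda>r. (D r, d r)) ` {..<m}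
     \<union> (\<lambda>j. ((\<lambda>i. if i \<in> {j} then 1 else 0), k j)) ` {..<Zi}
     \<union> (\<lambda>j. ((\<lambda>i. if i \<in> {j} then - 1 else 0), - k j)) ` {..<Zi}" for k :: "nat \<Rightarrow> real"
  have mem: "x \<in> poly_set {..<n} (C k) \<longleftrightarrow>
      (\<forall>j\<ge>n. x j = 0) \<and> (\<forall>j<Zi. x j = k j) \<and> (\<forall>r<m. rowdot n (D r) x \<le> d r)" for x k
  proof -
    have 1: "dot {..<n} (\<lambda>i. if i \<in> {j} then 1 else 0) x = x j"
      "dot {..<n} (\<lambda>i. if i \<in> {j} then - 1 else 0) x = - x j" if "j < Zi" for j
      using dot_indicator[of "{..<n}" "{j}" 1 x] dot_indicator[of "{..<n}" "{j}" "-1" x] that Zi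
      by simp_all
    have "(\<forall>(a, b)\<in>C k. dot {..<n} a x \<le> b) \<longleftrightarrow>
       (\<forall>r<m. rowdot n (D r) x \<le> d r) \<and> (\<forall>j<Zi. x j \<le> k j) \<and> (\<forall>j<Zi. - x j \<le> - k j)"
      unfolding C_def ball_Un rowdot_dot using 1 by simp blast
    moreover have "(\<forall>j<Zi. x j = k j) \<longleftrightarrow> (\<forall>j<Zi. x j \<le> k j) \<and> (\<forall>j<Zi. - x j \<le> - k j)"
      by (auto simp: order_eq_iff)
    ultimately show ?thesis unfolding poly_set_def by (auto simp: not_less)
  qed
  have sub: "poly_set {..<n} (C k) \<subseteq> ?X" if "k \<in> K" for k
  proof
    fix x assume "x \<in> poly_set {..<n} (C k)"
    moreover have "k j \<in> \<int>" if "j < Zi" for j using \<open>k \<in> K\<close> that unfolding K_def by auto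
    ultimately show "x \<in> ?X" unfolding mem milp_set_def by auto
  qed
  have "\<exists>V. finite V \<and> V \<subseteq> poly_set {..<n} (C k) \<and> poly_set {..<n} (C k) \<subseteq> fin_hull V"
    if "k \<in> K" for k
  proof (rule poly_set_finitely_generated)
    show "finite (C k)" unfolding C_def by auto
    show "bounded_on {..<n} (poly_set {..<n} (C k))"
      unfolding bounded_on_def using B sub[OF that] by (intro exI[of _ B]) auto
  qed auto
  then obtain V where V: "\<And>k. k \<in> K \<Longrightarrow> finite (V k)"
      "\<And>k. k \<in> K \<Longrightarrow> V k \<subseteq> poly_set {..<n} (C k)"
      "\<And>k. k \<in> K \<Longrightarrow> poly_set {..<n} (C k) \<subseteq> fin_hull (V k)"
    by metis
  show ?thesis
  proof (rule finitely_generatedI)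
    show fin: "finite (\<Union>k\<in>K. V k)" using Kfin V(1) by blast
    show "(\<Union>k\<in>K. V k) \<subseteq> ?X" using V(2) sub by blast
    show "?X \<subseteq> fin_hull (\<Union>k\<in>K. V k)"
    proof
      fix x assume x: "x \<in> ?X"
      \<comment> \<open>The restriction makes the integer part of x extensional, as membership in
        \<open>PiE\<close> requires.\<close>
      define k where "k = restrict x {..<Zi}"
      have k: "k \<in> K"
        unfolding k_def K_def using x B[OF x] Zi by (auto simp: milp_set_def)
      have "x \<in> poly_set {..<n} (C k)" unfolding mem using x by (auto simp: milp_set_def k_def)
      then have "x \<in> fin_hull (V k)" using V(3)[OF k] by blast
      then show "x \<in> fin_hull (\<Union>k\<in>K. V k)"
        using fin_hull_mono[OF fin, of "V k"] k by blast
    qed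
  qed
qed

text \<open>Rows are linear in the weights of a convex combination, so \<open>block_duality\<close>
  transfers to points of the hulls. The index type of the constraints stays free; later a cost bound
  and the local rows of all agents are handled as one system.\<close>

lemma conv_duality:
  assumes I: "finite I" and X: "\<And>i. i \<in> I \<Longrightarrow> finitely_generated (X i)" and E: "finite E"
    and hyp: "\<And>z. \<forall>i\<in>I. z i \<in> conv (X i) \<Longrightarrow>
        \<forall>s\<in>E. (\<Sum>i\<in>I. rowdot (n i) (a s i) (z i)) \<le> b s \<Longrightarrow>
        \<gamma> \<le> (\<Sum>i\<in>I. rowdot (n i) (f i) (z i))"
  shows "\<exists>\<mu>. (\<forall>s\<in>E. 0 \<le> \<mu> s) \<and> (\<forall>z. (\<forall>i\<in>I. z i \<in> conv (X i)) \<longrightarrow>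
     \<gamma> \<le> (\<Sum>i\<in>I. rowdot (n i) (f i) (z i))
        + (\<Sum>s\<in>E. \<mu> s * ((\<Sum>i\<in>I. rowdot (n i) (a s i) (z i)) - b s)))"
proof -
  obtain V where V: "\<And>i. i \<in> I \<Longrightarrow> finite (V i)" "\<And>i. i \<in> I \<Longrightarrow> conv (X i) = fin_hull (V i)"
    using X unfolding finitely_generated_def by metis
  have row: "rowdot n g (\<lambda>j. \<Sum>p\<in>V. w p * p j) = (\<Sum>p\<in>V. w p * rowdot n g p)" for n g V w
    unfolding rowdot_dot by (rule dot_sum)
  have "\<exists>\<mu>. (\<forall>s\<in>E. 0 \<le> \<mu> s) \<and> (\<forall>w. (\<forall>i\<in>I. weights (V i) (w i)) \<longrightarrow>
     \<gamma> \<le> (\<Sum>i\<in>I. \<Sum>p\<in>V i. w i p * rowdot (n i) (f i) p)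
        + (\<Sum>s\<in>E. \<mu> s * ((\<Sum>i\<in>I. \<Sum>p\<in>V i. w i p * rowdot (n i) (a s i) p) - b s)))"
  proof (rule block_duality[OF I V(1) E])
    fix w assume w: "\<forall>i\<in>I. weights (V i) (w i)"
      and le: "\<forall>s\<in>E. (\<Sum>i\<in>I. \<Sum>p\<in>V i. w i p * rowdot (n i) (a s i) p) \<le> b s"
    define z where "z i = (\<lambda>j. \<Sum>p\<in>V i. w i p * p j)" for i
    have "\<forall>i\<in>I. z i \<in> conv (X i)"
      using w by (auto simp: V(2) z_def intro: fin_hullI)
    then show "\<gamma> \<le> (\<Sum>i\<in>I. \<Sum>p\<in>V i. w i p * rowdot (n i) (f i) p)"
      using hyp[of z] le unfolding z_def row by blast
  qed
  then obtain \<mu> where \<mu>: "\<forall>s\<in>E. 0 \<le> \<mu> s"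
    "\<And>w. \<forall>i\<in>I. weights (V i) (w i) \<Longrightarrow>
     \<gamma> \<le> (\<Sum>i\<in>I. \<Sum>p\<in>V i. w i p * rowdot (n i) (f i) p)
        + (\<Sum>s\<in>E. \<mu> s * ((\<Sum>i\<in>I. \<Sum>p\<in>V i. w i p * rowdot (n i) (a s i) p) - b s))"
    by auto
  have "\<gamma> \<le> (\<Sum>i\<in>I. rowdot (n i) (f i) (z i))
        + (\<Sum>s\<in>E. \<mu> s * ((\<Sum>i\<in>I. rowdot (n i) (a s i) (z i)) - b s))"
    if z: "\<forall>i\<in>I. z i \<in> conv (X i)" for z
  proof -
    have "\<exists>w. weights (V i) w \<and> z i = (\<lambda>j. \<Sum>p\<in>V i. w p * p j)" if i: "i \<in> I" for i
    proof -
      have "z i \<in> fin_hull (V i)" using z V(2) i by blast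
      then show ?thesis by (rule fin_hullE) (rule exI, rule conjI)
    qed
    then obtain w where w: "\<And>i. i \<in> I \<Longrightarrow> weights (V i) (w i)"
        "\<And>i. i \<in> I \<Longrightarrow> z i = (\<lambda>j. \<Sum>p\<in>V i. w i p * p j)"
      by metis
    have "(\<Sum>i\<in>I. rowdot (n i) (g i) (z i)) = (\<Sum>i\<in>I. \<Sum>p\<in>V i. w i p * rowdot (n i) (g i) p)" for g
      by (rule sum.cong) (simp_all add: w(2) row)
    then show ?thesis using \<mu>(2)[of w] w(1) by simp
  qed
  then show ?thesis using \<mu>(1) by blast
qed

section \<open>Multipliers of the local problem\<close>

text \<open>The violation v ranges over a ray, which is not a polytope. It is first confined to a
  segment that has the optimal v in its interior or at its end 0, and treated as a second block. The
  Lagrangian is affine in v, so the bound extends to the whole ray once its slope is known to be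
  nonnegative.\<close>

lemma P1_strong_duality:
  fixes S :: nat
  assumes X: "finitely_generated X" and opt: "P1_primal_optimal S n c M A X y z v"
  shows "\<exists>\<mu>. (\<forall>s<S. 0 \<le> \<mu> s) \<and> (\<forall>z'\<in>conv X. \<forall>v'\<ge>0. rowdot n c z + M * v
     \<le> rowdot n c z' + M * v' + (\<Sum>s<S. \<mu> s * (rowdot n (A s) z' - y s - v')))"
proof -
  let ?\<gamma> = "rowdot n c z + M * v"
  have feas: "z \<in> conv X" "v \<ge> 0" "\<And>s. s < S \<Longrightarrow> rowdot n (A s) z \<le> y s + v"
    and best: "\<And>z' v'. P1_feasible S n A X y z' v' \<Longrightarrow> ?\<gamma> \<le> rowdot n c z' + M * v'"
    using opt unfolding P1_primal_optimal_def P1_feasible_def by auto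
  \<comment> \<open>Any bound strictly above v would do; the margin 1 makes the slope a plain
    difference of two values. Block 1 encodes v as coordinate 0 of a point between two constant
    functions.\<close>
  define B where "B = v + 1"
  define Y where "Y i = (if i = 0 then X else {\<lambda>_. 0, \<lambda>_. B})" for i :: nat
  define k where "k i = (if i = 0 then n else 1)" for i :: nat
  define a where "a s i = (if i = 0 then A s else (\<lambda>_. - 1))" for s and i :: nat
  define f where "f i = (if i = 0 then c else (\<lambda>_. M))" for i :: nat
  have sums: "(\<Sum>i\<in>{0, 1}. rowdot (k i) (f i) (x i)) = rowdot n c (x 0) + M * x 1 0"
    "(\<Sum>i\<in>{0, 1}. rowdot (k i) (a s i) (x i)) = rowdot n (A s) (x 0) - x 1 0" for x s
    by (simp_all add: k_def f_def a_def rowdot_def)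
  have pos: "x 0 \<ge> 0" if x: "x \<in> conv {\<lambda>_. 0, \<lambda>_. B}" for x
  proof -
    obtain F where F: "F \<subseteq> {\<lambda>_. 0, \<lambda>_. B}" "x \<in> fin_hull F"
      using x unfolding conv_iff by auto
    obtain w where w: "weights F w" "x = (\<lambda>j. \<Sum>p\<in>F. w p * p j)"
      using F(2) by (rule fin_hullE)
    have "\<And>p. p \<in> F \<Longrightarrow> p 0 \<ge> 0" using F(1) feas(2) unfolding B_def by auto
    then show ?thesis
      unfolding w(2) using w(1) by (intro sum_nonneg mult_nonneg_nonneg) (auto simp: weights_def)
  qed
  have inB: "(\<lambda>_. r) \<in> conv {\<lambda>_. 0, \<lambda>_. B}" if "0 \<le> r" "r \<le> B" for r
  proof -
    have B: "B > 0" using feas(2) by (simp add: B_def)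
    have "(\<lambda>j. (1 - r / B) * (\<lambda>_. 0) j + r / B * (\<lambda>_. B) j) \<in> conv {\<lambda>_. 0, \<lambda>_. B}"
      using that B by (intro conv_convex conv_inc) auto
    then show ?thesis using B by simp
  qed
  have "\<exists>\<mu>. (\<forall>s\<in>{..<S}. 0 \<le> \<mu> s) \<and> (\<forall>x. (\<forall>i\<in>{0, 1}. x i \<in> conv (Y i)) \<longrightarrow>
     ?\<gamma> \<le> (\<Sum>i\<in>{0, 1}. rowdot (k i) (f i) (x i))
        + (\<Sum>s\<in>{..<S}. \<mu> s * ((\<Sum>i\<in>{0, 1}. rowdot (k i) (a s i) (x i)) - y s)))"
  proof (rule conv_duality)
    show "finitely_generated (Y i)" for i
      using X by (auto simp: Y_def intro: finitely_generated_finite)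
    fix x assume x: "\<forall>i\<in>{0, 1}. x i \<in> conv (Y i)"
      and "\<forall>s\<in>{..<S}. (\<Sum>i\<in>{0, 1}. rowdot (k i) (a s i) (x i)) \<le> y s"
    then have le: "\<forall>s<S. rowdot n (A s) (x 0) \<le> y s + x 1 0" unfolding sums by force
    have "x 1 0 \<ge> 0" using x by (intro pos) (auto simp: Y_def)
    then have "P1_feasible S n A X y (x 0) (x 1 0)"
      unfolding P1_feasible_def using x le by (auto simp: Y_def)
    then show "?\<gamma> \<le> (\<Sum>i\<in>{0, 1}. rowdot (k i) (f i) (x i))" unfolding sums by (rule best)
  qed auto
  then obtain \<mu> where \<mu>: "\<forall>s<S. 0 \<le> \<mu> s" and
    dual: "\<And>x. \<forall>i\<in>{0, 1}. x i \<in> conv (Y i) \<Longrightarrow>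
     ?\<gamma> \<le> rowdot n c (x 0) + M * x 1 0
        + (\<Sum>s<S. \<mu> s * (rowdot n (A s) (x 0) - x 1 0 - y s))"
    unfolding sums by auto
  define L where "L z' v' = rowdot n c z' + M * v' + (\<Sum>s<S. \<mu> s * (rowdot n (A s) z' - y s - v'))" for z' v'
  have Lge: "?\<gamma> \<le> L z' r" if "z' \<in> conv X" "0 \<le> r" "r \<le> B" for z' r
    using dual[of "\<lambda>i. if i = 0 then z' else (\<lambda>_. r)"] that inB
    by (simp add: L_def Y_def algebra_simps)
  have Lin: "L z' v' = L z' 0 + (M - (\<Sum>s<S. \<mu> s)) * v'" for z' v'
    unfolding L_def by (simp add: algebra_simps sum.distrib sum_subtractf sum_distrib_left)
  \<comment> \<open>At z the Lagrangian is at most the optimal value for v and at least that value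
    for \<open>v + 1\<close>, so it cannot decrease in v.\<close>
  have "(\<Sum>s<S. \<mu> s * (rowdot n (A s) z - y s - v)) \<le> 0"
    using \<mu> feas(3) by (intro sum_nonpos mult_nonneg_nonpos) (auto simp: algebra_simps)
  then have "L z v \<le> ?\<gamma>" unfolding L_def by simp
  moreover have "?\<gamma> \<le> L z B" using feas by (intro Lge) (auto simp: B_def)
  moreover have "L z B - L z v = M - (\<Sum>s<S. \<mu> s)"
    using Lin[of z B] Lin[of z v] by (simp add: B_def algebra_simps)
  ultimately have slope: "M - (\<Sum>s<S. \<mu> s) \<ge> 0" by linarith
  have "?\<gamma> \<le> L z' v'" if "z' \<in> conv X" "v' \<ge> 0" for z' v'
  proof -
    have "?\<gamma> \<le> L z' 0" using that(1) feas(2) by (intro Lge) (auto simp: B_def)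
    also have "\<dots> \<le> L z' v'" using Lin[of z' v'] slope that(2) by simp
    finally show ?thesis .
  qed
  then show ?thesis using \<mu> unfolding L_def by blast
qed

text \<open>Strong duality shows that the dual function at any dual optimum reaches the primal
  value. Setting v' to 0 then gives the subgradient inequality of the local optimal value, and
  letting v' grow bounds the sum of the multipliers by M.\<close>

lemma P1_multiplier:
  assumes X: "finitely_generated X" and opt: "P1_primal_optimal S n c M A X y z v"
    and dopt: "P1_dual_optimal S n c M A X y \<mu>"
  shows "s < S \<Longrightarrow> 0 \<le> \<mu> s" and "(\<Sum>s<S. \<mu> s) \<le> M"
    and "z' \<in> conv X \<Longrightarrow>
      rowdot n c z + M * v \<le> rowdot n c z' + (\<Sum>s<S. \<mu> s * (rowdot n (A s) z' - y s))"
proof -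
  let ?\<gamma> = "rowdot n c z + M * v"
  obtain \<nu> where \<nu>: "\<forall>s<S. 0 \<le> \<nu> s" "\<forall>z'\<in>conv X. \<forall>v'\<ge>0. ?\<gamma>
     \<le> rowdot n c z' + M * v' + (\<Sum>s<S. \<nu> s * (rowdot n (A s) z' - y s - v'))"
    using P1_strong_duality[OF X opt] by auto
  have "ereal ?\<gamma> \<le> P1_dual_fun S n c M A X y \<nu>"
    unfolding P1_dual_fun_def by (rule INF_greatest) (use \<nu>(2) in auto)
  also have "\<dots> \<le> P1_dual_fun S n c M A X y \<mu>"
    using dopt \<nu>(1) unfolding P1_dual_optimal_def by blast
  finally have le: "ereal ?\<gamma> \<le> P1_dual_fun S n c M A X y \<mu>" .
  have L: "?\<gamma> \<le> rowdot n c z' + M * v' + (\<Sum>s<S. \<mu> s * (rowdot n (A s) z' - y s - v'))"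
    if "z' \<in> conv X" "v' \<ge> 0" for z' v'
  proof -
    have "P1_dual_fun S n c M A X y \<mu> \<le> ereal (rowdot n c z' + M * v'
        + (\<Sum>s<S. \<mu> s * (rowdot n (A s) z' - y s - v')))"
      unfolding P1_dual_fun_def by (rule INF_lower2[of "(z', v')"]) (use that in auto)
    with le show ?thesis by (meson ereal_less_eq(3) order_trans)
  qed
  show "s < S \<Longrightarrow> 0 \<le> \<mu> s" using dopt unfolding P1_dual_optimal_def by blast
  show "z' \<in> conv X \<Longrightarrow>
      ?\<gamma> \<le> rowdot n c z' + (\<Sum>s<S. \<mu> s * (rowdot n (A s) z' - y s))"
    using L[of z' 0] by simp
  show "(\<Sum>s<S. \<mu> s) \<le> M"
  proof (rule ccontr)
    assume neg: "\<not> (\<Sum>s<S. \<mu> s) \<le> M"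
    define m where "m = (\<Sum>s<S. \<mu> s) - M"
    define q where "q = rowdot n c z + (\<Sum>s<S. \<mu> s * (rowdot n (A s) z - y s)) - ?\<gamma>"
    have m: "m > 0" using neg by (simp add: m_def)
    have "m * r \<le> q" if "r \<ge> 0" for r
      using L[of z r] that opt unfolding m_def q_def P1_primal_optimal_def P1_feasible_def
      by (simp add: algebra_simps sum.distrib sum_subtractf sum_distrib_left)
    \<comment> \<open>At this r the product \<open>m * r\<close> equals
      \<open>\<bar>q\<bar> + 1\<close>, which exceeds q.\<close>
    from this[of "(\<bar>q\<bar> + 1) / m"] show False using m by simp
  qed
qed

section \<open>The allocation dynamics\<close>

text \<open>Maximum principle: going from a maximiser of U along an edge, U drops by a bounded amount.\<close>

lemma laplacian_oscillation_bound:
  fixes C :: real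
  assumes graph: "connected_graph N Nb" and C: "C \<ge> 0"
  shows "\<exists>R\<ge>0. \<forall>U. (\<forall>i<N. (\<Sum>j\<in>Nb i. U i - U j) \<le> C) \<longrightarrow> (\<forall>i<N. \<forall>j<N. U i - U j \<le> R)"
proof -
  define E where "E = {(a, b). a < N \<and> b < N \<and> b \<in> Nb a}"
  have Nb: "\<And>i. i < N \<Longrightarrow> Nb i \<subseteq> {..<N}" and conn: "\<And>i j. i < N \<Longrightarrow> j < N \<Longrightarrow> (i, j) \<in> E\<^sup>*"
    using graph unfolding connected_graph_def E_def by auto
  \<comment> \<open>The drop r is chosen before U, so that one bound serves the accumulated
    multipliers at all times.\<close>
  define P where "P i r j \<longleftrightarrow> (\<forall>U. (\<forall>i<N. (\<Sum>j\<in>Nb i. U i - U j) \<le> C) \<longrightarrow> (\<forall>l<N. U l \<le> U i) \<longrightarrow> U i - U j \<le> r)"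
    for i j :: nat and r :: real
  have "\<exists>r\<ge>0. P i r j" if "(i, j) \<in> E\<^sup>*" for i j
    using that
  proof (induction rule: rtrancl_induct)
    case base
    show ?case by (intro exI[of _ 0]) (simp add: P_def)
  next
    case (step j k)
    then obtain r where r: "r \<ge> 0" "P i r j" by blast
    have jk: "j < N" "k < N" "k \<in> Nb j" using step.hyps(2) by (auto simp: E_def)
    have fin: "finite (Nb j)" "card (Nb j) \<le> N"
      using Nb[OF jk(1)] finite_subset card_mono[OF finite_lessThan Nb[OF jk(1)]] by auto
    \<comment> \<open>The Laplacian at j is at most C and each of its other terms is at least - r,
      so the term of the edge to k is at most \<open>C + real N * r\<close>.\<close>
    have "P i (r + (C + real N * r)) k"
      unfolding P_def
    proof (intro allI impI)
      fix U :: "nat \<Rightarrow> real"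
      assume lap: "\<forall>i<N. (\<Sum>j\<in>Nb i. U i - U j) \<le> C" and mx: "\<forall>l<N. U l \<le> U i"
      have ij: "U i - U j \<le> r" using r(2) lap mx unfolding P_def by blast
      have "(\<Sum>l\<in>Nb j - {k}. - r) \<le> (\<Sum>l\<in>Nb j - {k}. U j - U l)"
      proof (rule sum_mono)
        fix l assume "l \<in> Nb j - {k}"
        then have "U l \<le> U i" using mx Nb[OF jk(1)] by auto
        then show "- r \<le> U j - U l" using ij by linarith
      qed
      moreover have "(\<Sum>l\<in>Nb j - {k}. - r) = - (real (card (Nb j - {k})) * r)" by simp
      moreover have "real (card (Nb j - {k})) * r \<le> real N * r"
        using fin r(1) card_mono[OF fin(1), of "Nb j - {k}"] by (intro mult_right_mono) auto
      moreover have "(\<Sum>l\<in>Nb j. U j - U l) = (U j - U k) + (\<Sum>l\<in>Nb j - {k}. U j - U l)"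
        using fin jk by (simp add: sum.remove)
      moreover have "(\<Sum>l\<in>Nb j. U j - U l) \<le> C" using lap jk by blast
      ultimately have "U j - U k \<le> C + real N * r" by linarith
      then show "U i - U k \<le> r + (C + real N * r)" using ij by linarith
    qed
    moreover have "r + (C + real N * r) \<ge> 0" using r(1) C by simp
    ultimately show ?case by blast
  qed
  then have "\<exists>r. i < N \<longrightarrow> j < N \<longrightarrow> r \<ge> 0 \<and> P i r j" for i j using conn by blast
  then obtain r where r: "\<And>i j. i < N \<Longrightarrow> j < N \<Longrightarrow> r i j \<ge> 0 \<and> P i (r i j) j" by metis
  define R where "R = (\<Sum>i<N. \<Sum>j<N. r i j)"
  have rR: "r i j \<le> R" if "i < N" "j < N" for i j
  proof -
    have "r i j \<le> (\<Sum>j<N. r i j)" using that r by (intro member_le_sum) auto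
    also have "\<dots> \<le> R" unfolding R_def
      using that r by (intro member_le_sum[of i "{..<N}" "\<lambda>i. \<Sum>j<N. r i j"] sum_nonneg) auto
    finally show ?thesis .
  qed
  have "U i - U j \<le> R" if lap: "\<forall>i<N. (\<Sum>j\<in>Nb i. U i - U j) \<le> C" and ij: "i < N" "j < N"
    for U :: "nat \<Rightarrow> real" and i j
  proof -
    have "Max (U ` {..<N}) \<in> U ` {..<N}" using ij by (intro Max_in) auto
    then obtain m where m: "m < N" "U m = Max (U ` {..<N})" by auto
    have mx: "\<forall>l<N. U l \<le> U m" unfolding m(2) by auto
    then have "U m - U j \<le> r m j" using r[OF m(1) ij(2)] lap unfolding P_def by blast
    then show ?thesis using mx rR[OF m(1) ij(2)] ij(1) by fastforce
  qed
  moreover have "R \<ge> 0" unfolding R_def using r by (intro sum_nonneg) auto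
  ultimately show ?thesis by blast
qed

text \<open>Exchanging the two ends of each edge negates the sum. Hence the updates preserve the
  total allocation.\<close>

lemma laplacian_sum_zero:
  fixes g :: "nat \<Rightarrow> real"
  assumes graph: "connected_graph N Nb"
  shows "(\<Sum>i<N. \<Sum>j\<in>Nb i. g i - g j) = 0"
proof -
  have Nb: "\<And>i. i < N \<Longrightarrow> Nb i \<subseteq> {..<N}"
    and sym: "\<And>i j. i < N \<Longrightarrow> j < N \<Longrightarrow> j \<in> Nb i \<longleftrightarrow> i \<in> Nb j"
    using graph unfolding connected_graph_def by blast+
  define Q where "Q = (\<Sum>i<N. \<Sum>j<N. if j \<in> Nb i then g i - g j else 0)"
  have "(\<Sum>i<N. \<Sum>j\<in>Nb i. g i - g j) = Q"
    unfolding Q_def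
  proof (rule sum.cong)
    fix i assume "i \<in> {..<N}"
    then have "{..<N} \<inter> Nb i = Nb i" using Nb by auto
    then show "(\<Sum>j\<in>Nb i. g i - g j) = (\<Sum>j<N. if j \<in> Nb i then g i - g j else 0)"
      by (simp add: sum.inter_restrict[symmetric])
  qed simp
  moreover have "Q = (\<Sum>j<N. \<Sum>i<N. if j \<in> Nb i then g i - g j else 0)"
    unfolding Q_def by (rule sum.swap)
  moreover have "\<dots> = (\<Sum>j<N. \<Sum>i<N. - (if i \<in> Nb j then g j - g i else 0))"
    by (intro sum.cong refl) (use sym in auto)
  moreover have "\<dots> = - Q" unfolding Q_def by (simp add: sum_negf)
  ultimately show ?thesis by linarith
qed

text \<open>The accumulated multipliers U satisfy y T - y 0 = L U with L the graph Laplacian. As the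
  left-hand side is bounded, U is bounded modulo constants, so pairing the multipliers with a
  direction h of zero sum cannot stay below a negative number while the step sizes sum to infinity.\<close>

lemma multiplier_pairing:
  fixes \<alpha> :: "nat \<Rightarrow> real" and y \<mu> :: "nat \<Rightarrow> nat \<Rightarrow> nat \<Rightarrow> real" and h :: "nat \<Rightarrow> nat \<Rightarrow> real"
  assumes graph: "connected_graph N Nb" and N: "N \<ge> 1"
    and \<alpha>: "\<And>t. \<alpha> t \<ge> 0" "\<not> summable \<alpha>"
    and rec: "\<And>t i s. i < N \<Longrightarrow> s < S \<Longrightarrow>
        y (Suc t) i s = y t i s + \<alpha> t * (\<Sum>j\<in>Nb i. \<mu> t i s - \<mu> t j s)"
    and conv: "\<And>i s. i < N \<Longrightarrow> s < S \<Longrightarrow> convergent (\<lambda>t. y t i s)"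
    and h: "\<And>s. s < S \<Longrightarrow> (\<Sum>i<N. h i s) = 0"
    and \<epsilon>: "\<epsilon> > 0"
  shows "\<exists>t\<ge>T0. - \<epsilon> < (\<Sum>i<N. \<Sum>s<S. \<mu> t i s * h i s)"
proof (rule ccontr)
  define G where "G t = (\<Sum>i<N. \<Sum>s<S. \<mu> t i s * h i s)" for t
  assume "\<not> ?thesis"
  then have Gle: "G t \<le> - \<epsilon>" if "t \<ge> T0" for t using that unfolding G_def by force
  define U where "U T s i = (\<Sum>t<T. \<alpha> t * \<mu> t i s)" for T s i
  have lap: "(\<Sum>j\<in>Nb i. U T s i - U T s j) = y T i s - y 0 i s" if "i < N" "s < S" for T i s
  proof (induction T)
    case 0
    then show ?case by (simp add: U_def)
  next
    case (Suc T)
    have "(\<Sum>j\<in>Nb i. U (Suc T) s i - U (Suc T) s j) =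
        (\<Sum>j\<in>Nb i. U T s i - U T s j) + \<alpha> T * (\<Sum>j\<in>Nb i. \<mu> T i s - \<mu> T j s)"
      unfolding U_def by (simp add: sum_distrib_left algebra_simps sum.distrib sum_subtractf)
    then show ?case using Suc rec[OF that] by simp
  qed
  have "\<exists>B. \<forall>T. \<bar>y T i s\<bar> \<le> B" if "i < N" "s < S" for i s
    using convergent_imp_Bseq[OF conv[OF that]] unfolding Bseq_def by auto
  then obtain B where B: "\<And>i s T. i < N \<Longrightarrow> s < S \<Longrightarrow> \<bar>y T i s\<bar> \<le> B i s" by metis
  define C where "C = (\<Sum>i<N. \<Sum>s<S. 2 * B i s)"
  have B0: "B i s \<ge> 0" if "i < N" "s < S" for i s using B[OF that, of 0] by linarith
  have BC: "2 * B i s \<le> C" if "i < N" "s < S" for i s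
  proof -
    have "2 * B i s \<le> (\<Sum>s<S. 2 * B i s)"
      using that B0 by (intro member_le_sum[of s "{..<S}" "\<lambda>s. 2 * B i s"]) auto
    also have "\<dots> \<le> C" unfolding C_def
      using that B0 by (intro member_le_sum[of i "{..<N}" "\<lambda>i. \<Sum>s<S. 2 * B i s"] sum_nonneg) auto
    finally show ?thesis .
  qed
  have C0: "C \<ge> 0" unfolding C_def using B0 by (intro sum_nonneg) auto
  obtain R where R: "R \<ge> 0"
    "\<And>U i j. \<forall>i<N. (\<Sum>j\<in>Nb i. U i - U j) \<le> C \<Longrightarrow> i < N \<Longrightarrow> j < N \<Longrightarrow> U i - U j \<le> R"
    using laplacian_oscillation_bound[OF graph C0] by blast
  have UR: "\<bar>U T s i - U T s 0\<bar> \<le> R" if "s < S" "i < N" for T s i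
  proof -
    have "\<forall>i<N. (\<Sum>j\<in>Nb i. U T s i - U T s j) \<le> C"
    proof (intro allI impI)
      fix i assume i: "i < N"
      show "(\<Sum>j\<in>Nb i. U T s i - U T s j) \<le> C"
        unfolding lap[OF i that(1)]
        using B[OF i that(1), of T] B[OF i that(1), of 0] BC[OF i that(1)] by linarith
    qed
    then have "U T s i - U T s 0 \<le> R" "U T s 0 - U T s i \<le> R"
      using R(2)[of "U T s"] that N by auto
    then show ?thesis by linarith
  qed
  define H where "H = R * (\<Sum>s<S. \<Sum>i<N. \<bar>h i s\<bar>)"
  have low: "- H \<le> (\<Sum>t<T. \<alpha> t * G t)" for T
  proof -
    have "(\<Sum>t<T. \<alpha> t * G t) = (\<Sum>t<T. \<Sum>s<S. \<Sum>i<N. \<alpha> t * \<mu> t i s * h i s)"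
      unfolding G_def by (subst sum.swap) (simp add: sum_distrib_left mult.assoc)
    also have "\<dots> = (\<Sum>s<S. \<Sum>t<T. \<Sum>i<N. \<alpha> t * \<mu> t i s * h i s)" by (rule sum.swap)
    also have "\<dots> = (\<Sum>s<S. \<Sum>i<N. U T s i * h i s)"
      unfolding U_def sum_distrib_right by (rule sum.cong[OF refl]) (rule sum.swap)
    \<comment> \<open>U is controlled only up to a constant for each s. As h has zero sum over the
      agents, the value at agent 0 may be subtracted.\<close>
    also have "\<dots> = (\<Sum>s<S. \<Sum>i<N. (U T s i - U T s 0) * h i s)"
    proof (rule sum.cong[OF refl])
      fix s assume "s \<in> {..<S}"
      then have "(\<Sum>i<N. U T s 0 * h i s) = 0" using h by (simp add: sum_distrib_left[symmetric])
      then show "(\<Sum>i<N. U T s i * h i s) = (\<Sum>i<N. (U T s i - U T s 0) * h i s)"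
        by (simp add: left_diff_distrib sum_subtractf)
    qed
    also have "\<dots> \<ge> (\<Sum>s<S. \<Sum>i<N. - (R * \<bar>h i s\<bar>))"
    proof (intro sum_mono)
      fix s i assume "s \<in> {..<S}" "i \<in> {..<N}"
      then have "\<bar>U T s i - U T s 0\<bar> * \<bar>h i s\<bar> \<le> R * \<bar>h i s\<bar>"
        using UR by (intro mult_right_mono) auto
      then have "\<bar>(U T s i - U T s 0) * h i s\<bar> \<le> R * \<bar>h i s\<bar>" by (simp add: abs_mult)
      then show "- (R * \<bar>h i s\<bar>) \<le> (U T s i - U T s 0) * h i s" by linarith
    qed
    moreover have "(\<Sum>s<S. \<Sum>i<N. - (R * \<bar>h i s\<bar>)) = - H"
      unfolding H_def by (simp add: sum_negf sum_distrib_left)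
    ultimately show ?thesis by linarith
  qed
  have shift: "(\<Sum>t<T + T0. f t) = (\<Sum>t<T0. f t) + (\<Sum>t<T. f (t + T0))" for f :: "nat \<Rightarrow> real" and T
    by (induction T) auto
  \<comment> \<open>From T0 on each term of the weighted pairing is at most
    \<open>- \<epsilon> * \<alpha> t\<close>, while its partial sums stay above - H; this would make
    the step sizes summable.\<close>
  have "summable (\<lambda>t. \<alpha> (t + T0))"
  proof (rule summableI_nonneg_bounded)
    show "0 \<le> \<alpha> (t + T0)" for t by (rule \<alpha>(1))
    fix T
    have "\<epsilon> * (\<Sum>t<T. \<alpha> (t + T0)) \<le> (\<Sum>t<T. - (\<alpha> (t + T0) * G (t + T0)))"
      unfolding sum_distrib_left
    proof (rule sum_mono)
      fix t
      have "\<alpha> (t + T0) * G (t + T0) \<le> \<alpha> (t + T0) * - \<epsilon>"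
        using Gle[of "t + T0"] \<alpha>(1)[of "t + T0"] by (intro mult_left_mono) auto
      then show "\<epsilon> * \<alpha> (t + T0) \<le> - (\<alpha> (t + T0) * G (t + T0))" by (simp add: mult.commute)
    qed
    also have "\<dots> = (\<Sum>t<T0. \<alpha> t * G t) - (\<Sum>t<T + T0. \<alpha> t * G t)"
      unfolding shift[of "\<lambda>t. \<alpha> t * G t"] by (simp add: sum_negf)
    also have "\<dots> \<le> (\<Sum>t<T0. \<alpha> t * G t) + H" using low[of "T + T0"] by linarith
    finally show "(\<Sum>t<T. \<alpha> (t + T0)) \<le> ((\<Sum>t<T0. \<alpha> t * G t) + H) / \<epsilon>"
      using \<epsilon> by (simp add: pos_le_divide_eq mult.commute)
  qed
  then show False using \<alpha>(2) by (simp add: summable_iff_shift)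
qed

section \<open>The restricted linear program\<close>

text \<open>K is the sum of a set of multipliers of the restricted LP: relaxing every row by v
  lowers the optimal value by at most K v.\<close>

lemma LPr_exact_penalty:
  fixes S :: nat
  assumes X: "\<And>i. i < N \<Longrightarrow> finitely_generated (X i)"
    and opt: "LPr_optimal N S n c A X b r zopt"
  shows "\<exists>K\<ge>0. \<forall>z. \<forall>v\<ge>0. (\<forall>i<N. z i \<in> conv (X i)) \<longrightarrow>
     (\<forall>s<S. (\<Sum>i<N. rowdot (n i) (A i s) (z i)) \<le> b s - r s + v) \<longrightarrow>
     (\<Sum>i<N. rowdot (n i) (c i) (zopt i)) \<le> (\<Sum>i<N. rowdot (n i) (c i) (z i)) + K * v"
proof -
  let ?J = "\<Sum>i<N. rowdot (n i) (c i) (zopt i)"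
  have "\<exists>\<nu>. (\<forall>s\<in>{..<S}. 0 \<le> \<nu> s) \<and> (\<forall>z. (\<forall>i\<in>{..<N}. z i \<in> conv (X i)) \<longrightarrow>
     ?J \<le> (\<Sum>i<N. rowdot (n i) (c i) (z i))
        + (\<Sum>s<S. \<nu> s * ((\<Sum>i<N. rowdot (n i) (A i s) (z i)) - (b s - r s))))"
    using opt X by (intro conv_duality) (auto simp: LPr_optimal_def LPr_feasible_def)
  then obtain \<nu> where \<nu>: "\<forall>s\<in>{..<S}. 0 \<le> \<nu> s"
     "\<forall>z. (\<forall>i\<in>{..<N}. z i \<in> conv (X i)) \<longrightarrow> ?J \<le> (\<Sum>i<N. rowdot (n i) (c i) (z i))
        + (\<Sum>s<S. \<nu> s * ((\<Sum>i<N. rowdot (n i) (A i s) (z i)) - (b s - r s)))"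
    by (elim exE conjE) (rule that)
  show ?thesis
  proof (intro exI[of _ "\<Sum>s<S. \<nu> s"] conjI allI impI)
    show "0 \<le> (\<Sum>s<S. \<nu> s)" using \<nu>(1) by (intro sum_nonneg) auto
    fix z and v :: real
    assume v: "0 \<le> v" and z: "\<forall>i<N. z i \<in> conv (X i)"
      and le: "\<forall>s<S. (\<Sum>i<N. rowdot (n i) (A i s) (z i)) \<le> b s - r s + v"
    have "(\<Sum>s<S. \<nu> s * ((\<Sum>i<N. rowdot (n i) (A i s) (z i)) - (b s - r s))) \<le> (\<Sum>s<S. \<nu> s * v)"
      using \<nu>(1) le by (intro sum_mono mult_left_mono) (auto simp: algebra_simps)
    also have "\<dots> = (\<Sum>s<S. \<nu> s) * v" by (simp add: sum_distrib_right)
    finally show "?J \<le> (\<Sum>i<N. rowdot (n i) (c i) (z i)) + (\<Sum>s<S. \<nu> s) * v"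
      using \<nu>(2)[rule_format, of z] z by fastforce
  qed
qed

text \<open>Duality applied to an infeasible system yields a certificate that excludes small violations.\<close>

lemma feasible_if_nearly_feasible:
  assumes I: "finite I" and X: "\<And>i. i \<in> I \<Longrightarrow> finitely_generated (X i)" and E: "finite E"
    and near: "\<And>\<epsilon>. \<epsilon> > 0 \<Longrightarrow> \<exists>z. (\<forall>i\<in>I. z i \<in> conv (X i)) \<and>
        (\<forall>s\<in>E. (\<Sum>i\<in>I. rowdot (n i) (a s i) (z i)) \<le> b s + \<epsilon>)"
  shows "\<exists>z. (\<forall>i\<in>I. z i \<in> conv (X i)) \<and> (\<forall>s\<in>E. (\<Sum>i\<in>I. rowdot (n i) (a s i) (z i)) \<le> b s)"
proof (rule ccontr)
  assume no: "\<not> ?thesis"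
  have zero: "rowdot n (\<lambda>_. 0) x = 0" for n x by (simp add: rowdot_def)
  \<comment> \<open>With objective 0 the lower bound 1 is vacuously valid on an empty feasible set,
    so the multipliers form a Farkas certificate.\<close>
  have "\<exists>\<mu>. (\<forall>s\<in>E. 0 \<le> \<mu> s) \<and> (\<forall>z. (\<forall>i\<in>I. z i \<in> conv (X i)) \<longrightarrow>
     1 \<le> (\<Sum>i\<in>I. rowdot (n i) (\<lambda>_. 0) (z i))
        + (\<Sum>s\<in>E. \<mu> s * ((\<Sum>i\<in>I. rowdot (n i) (a s i) (z i)) - b s)))"
    using no by (intro conv_duality[OF I X E]) auto
  then obtain \<mu> where \<mu>: "\<forall>s\<in>E. 0 \<le> \<mu> s"
     "\<And>z. \<forall>i\<in>I. z i \<in> conv (X i) \<Longrightarrow>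
       1 \<le> (\<Sum>s\<in>E. \<mu> s * ((\<Sum>i\<in>I. rowdot (n i) (a s i) (z i)) - b s))"
    unfolding zero by auto
  define m where "m = sum \<mu> E"
  have m: "m \<ge> 0" unfolding m_def using \<mu>(1) by (intro sum_nonneg) auto
  obtain z where z: "\<forall>i\<in>I. z i \<in> conv (X i)"
      "\<forall>s\<in>E. (\<Sum>i\<in>I. rowdot (n i) (a s i) (z i)) \<le> b s + 1 / (m + 1)"
    using near[of "1 / (m + 1)"] m by auto
  have "1 \<le> (\<Sum>s\<in>E. \<mu> s * ((\<Sum>i\<in>I. rowdot (n i) (a s i) (z i)) - b s))" by (rule \<mu>(2)[OF z(1)])
  also have "\<dots> \<le> (\<Sum>s\<in>E. \<mu> s * (1 / (m + 1)))"
    using \<mu>(1) z(2) by (intro sum_mono mult_left_mono) (auto simp: algebra_simps)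
  also have "\<dots> = m / (m + 1)" by (simp add: m_def sum_divide_distrib)
  also have "\<dots> < 1" using m by simp
  finally show False by simp
qed

text \<open>Gaussian elimination on the last row. In the application the unknowns are step lengths,
  one for each block outside its \<open>X i\<close>, and the equations are the coupling
  rows.\<close>

lemma homogeneous_system_nontrivial_solution:
  fixes a :: "nat \<Rightarrow> 'i \<Rightarrow> real"
  assumes "finite F" "S < card F"
  shows "\<exists>\<delta>. (\<exists>i\<in>F. \<delta> i \<noteq> 0) \<and> (\<forall>s<S. (\<Sum>i\<in>F. \<delta> i * a s i) = 0)"
  using assms
proof (induction S arbitrary: F a)
  case 0
  then have "F \<noteq> {}" by auto
  then show ?case by (intro exI[of _ "\<lambda>_. 1"]) auto
next
  case (Suc S)
  show ?case
  proof (cases "\<forall>i\<in>F. a S i = 0")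
    case True
    obtain \<delta> where "\<exists>i\<in>F. \<delta> i \<noteq> 0" "\<forall>s<S. (\<Sum>i\<in>F. \<delta> i * a s i) = 0"
      using Suc.IH[of F a] Suc.prems by auto
    then show ?thesis using True by (intro exI[of _ \<delta>]) (auto simp: less_Suc_eq)
  next
    case False
    then obtain k where k: "k \<in> F" "a S k \<noteq> 0" by blast
    define G where "G = F - {k}"
    have G: "finite G" "k \<notin> G" "F = insert k G" using Suc.prems(1) k(1) unfolding G_def by auto
    have "S < card G" using Suc.prems(2) G by simp
    then obtain \<delta> where \<delta>: "\<exists>i\<in>G. \<delta> i \<noteq> 0"
        "\<forall>s<S. (\<Sum>i\<in>G. \<delta> i * (a s i - a s k * a S i / a S k)) = 0"
      using Suc.IH[OF G(1), of "\<lambda>s i. a s i - a s k * a S i / a S k"] by auto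
    \<comment> \<open>The value of the pivot unknown that solves row S.\<close>
    define q where "q = - (\<Sum>i\<in>G. \<delta> i * a S i) / a S k"
    define \<delta>' where "\<delta>' = \<delta>(k := q)"
    have sumF: "(\<Sum>i\<in>F. \<delta>' i * a s i) = q * a s k + (\<Sum>i\<in>G. \<delta> i * a s i)" for s
    proof -
      have "(\<Sum>i\<in>G. \<delta>' i * a s i) = (\<Sum>i\<in>G. \<delta> i * a s i)"
        using G(2) by (intro sum.cong) (auto simp: \<delta>'_def)
      then show ?thesis using G by (simp add: \<delta>'_def)
    qed
    have "(\<Sum>i\<in>F. \<delta>' i * a s i) = 0" if "s < Suc S" for s
    proof (cases "s = S")
      case True
      then show ?thesis unfolding sumF using k(2) by (simp add: q_def)
    next
      case False
      then have "0 = (\<Sum>i\<in>G. \<delta> i * (a s i - a s k * a S i / a S k))" using \<delta>(2) that by simp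
      also have "\<dots> = (\<Sum>i\<in>G. \<delta> i * a s i) - (\<Sum>i\<in>G. \<delta> i * a S i) / a S k * a s k"
        by (simp add: right_diff_distrib sum_subtractf sum_distrib_left sum_divide_distrib mult_ac)
      finally show ?thesis unfolding sumF by (simp add: q_def)
    qed
    moreover have "\<exists>i\<in>F. \<delta>' i \<noteq> 0" using \<delta>(1) G by (force simp: \<delta>'_def)
    ultimately show ?thesis by blast
  qed
qed

text \<open>A convex combination that is not itself a point of X gives positive weight to two points
  p and q. Shifting weight between them, up to the smaller of the two weights, moves z both ways
  along p - q.\<close>

lemma conv_segment:
  assumes z: "z \<in> conv X" "z \<notin> X"
  shows "\<exists>d \<tau>. d \<noteq> (\<lambda>_. 0) \<and> \<tau> > 0 \<and> (\<forall>t. \<bar>t\<bar> \<le> \<tau> \<longrightarrow> (\<lambda>j. z j + t * d j) \<in> conv X)"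
proof -
  obtain F where F: "finite F" "F \<subseteq> X" "z \<in> fin_hull F" using z(1) unfolding conv_iff by auto
  obtain w where w: "weights F w" "z = (\<lambda>j. \<Sum>p\<in>F. w p * p j)" using F(3) by (rule fin_hullE)
  have "\<exists>p\<in>F. w p \<noteq> 0" using w(1) by (auto simp: weights_def intro: ccontr)
  then obtain p where p: "p \<in> F" "w p \<noteq> 0" by blast
  have "\<exists>q\<in>F - {p}. w q \<noteq> 0"
  proof (rule ccontr)
    assume "\<not> ?thesis"
    then have q0: "\<forall>q\<in>F - {p}. w q = 0" by blast
    have s: "(\<Sum>q\<in>F. w q * g q) = w p * g p" for g :: "_ \<Rightarrow> real"
      using F(1) p(1) q0 by (simp add: sum.remove)
    have "w p = 1" using s[of "\<lambda>_. 1"] w(1) by (simp add: weights_def)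
    then have "z = p" unfolding w(2) s by simp
    then show False using z(2) p(1) F(2) by blast
  qed
  then obtain q where q: "q \<in> F" "q \<noteq> p" "w q \<noteq> 0" by blast
  define \<tau> where "\<tau> = min (w p) (w q)"
  have wpos: "w p > 0" "w q > 0" using w(1) p q by (auto simp: weights_def less_le)
  have "(\<lambda>j. z j + t * (p j - q j)) \<in> conv X" if t: "\<bar>t\<bar> \<le> \<tau>" for t
  proof -
    define u where "u = w(p := w p + t, q := w q - t)"
    have s: "(\<Sum>x\<in>F. u x * g x) = (\<Sum>x\<in>F. w x * g x) + t * (g p - g q)" for g :: "_ \<Rightarrow> real"
    proof -
      have rest: "(\<Sum>x\<in>F - {p} - {q}. u x * g x) = (\<Sum>x\<in>F - {p} - {q}. w x * g x)"
        by (rule sum.cong) (auto simp: u_def)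
      have split: "(\<Sum>x\<in>F. v x * g x) = v p * g p + (v q * g q + (\<Sum>x\<in>F - {p} - {q}. v x * g x))"
        for v :: "_ \<Rightarrow> real"
        using F(1) p(1) q(1,2) by (simp add: sum.remove[of F p] sum.remove[of "F - {p}" q])
      have upd: "u p = w p + t" "u q = w q - t" using q(2) by (simp_all add: u_def)
      show ?thesis unfolding split[of u] split[of w] rest upd by (simp add: algebra_simps)
    qed
    have "weights F u"
      using w(1) t s[of "\<lambda>_. 1"] unfolding weights_def u_def \<tau>_def by auto
    moreover have "(\<lambda>j. z j + t * (p j - q j)) = (\<lambda>j. \<Sum>x\<in>F. u x * x j)"
      unfolding w(2) s by simp
    ultimately have "(\<lambda>j. z j + t * (p j - q j)) \<in> fin_hull F" by (rule fin_hullI)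
    then show ?thesis unfolding conv_iff using F by auto
  qed
  moreover have "(\<lambda>j. p j - q j) \<noteq> (\<lambda>_. 0)" using q(2) by (fastforce simp: fun_eq_iff)
  moreover have "\<tau> > 0" using wpos by (simp add: \<tau>_def)
  ultimately show ?thesis by blast
qed

text \<open>With more than S blocks outside their X i, the S coupling rows leave a direction along which
  the optimal solution could be moved both ways.\<close>

lemma card_fractional_le:
  fixes S :: nat
  assumes opt: "LPr_optimal N S n c A X b r z"
    and unique: "\<And>z'. LPr_optimal N S n c A X b r z' \<Longrightarrow> \<forall>i<N. z' i = z i"
  shows "card {i. i < N \<and> z i \<notin> X i} \<le> S"
proof (rule ccontr)
  define F where "F = {i. i < N \<and> z i \<notin> X i}"
  assume "\<not> card {i. i < N \<and> z i \<notin> X i} \<le> S"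
  then have card: "S < card F" by (simp add: F_def)
  have F: "finite F" "F \<subseteq> {..<N}" unfolding F_def by auto
  have feas: "\<forall>i<N. z i \<in> conv (X i)"
      "\<forall>s<S. (\<Sum>i<N. rowdot (n i) (A i s) (z i)) \<le> b s - r s"
    and best: "\<And>z'. LPr_feasible N S n A X b r z' \<Longrightarrow>
        (\<Sum>i<N. rowdot (n i) (c i) (z i)) \<le> (\<Sum>i<N. rowdot (n i) (c i) (z' i))"
    using opt unfolding LPr_optimal_def LPr_feasible_def by auto
  have "\<exists>d \<tau>. d \<noteq> (\<lambda>_. 0) \<and> \<tau> > 0 \<and> (\<forall>t. \<bar>t\<bar> \<le> \<tau> \<longrightarrow> (\<lambda>j. z i j + t * d j) \<in> conv (X i))"
    if "i \<in> F" for i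
    using that feas(1) by (intro conv_segment) (auto simp: F_def)
  then obtain d \<tau> where d: "\<And>i. i \<in> F \<Longrightarrow> d i \<noteq> (\<lambda>_. 0)" "\<And>i. i \<in> F \<Longrightarrow> \<tau> i > 0"
      "\<And>i t. i \<in> F \<Longrightarrow> \<bar>t\<bar> \<le> \<tau> i \<Longrightarrow> (\<lambda>j. z i j + t * d i j) \<in> conv (X i)"
    by metis
  obtain \<delta> where \<delta>: "\<exists>i\<in>F. \<delta> i \<noteq> 0" "\<forall>s<S. (\<Sum>i\<in>F. \<delta> i * rowdot (n i) (A i s) (d i)) = 0"
    using homogeneous_system_nontrivial_solution[OF F(1) card, of "\<lambda>s i. rowdot (n i) (A i s) (d i)"]
    by auto
  have Fne: "F \<noteq> {}" using card by auto
  \<comment> \<open>The summand 1 keeps D positive. Dividing the smallest \<tau> by D keeps all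
    blocks inside their segments at once.\<close>
  define D where "D = 1 + (\<Sum>i\<in>F. \<bar>\<delta> i\<bar>)"
  have D: "D > 0" unfolding D_def by (simp add: add_pos_nonneg sum_nonneg)
  define e where "e = Min (\<tau> ` F) / D"
  have "Min (\<tau> ` F) > 0" using F(1) Fne d(2) by (simp add: Min_gr_iff)
  then have e: "e > 0" using D by (simp add: e_def)
  have small: "\<bar>e * \<delta> i\<bar> \<le> \<tau> i" if "i \<in> F" for i
  proof -
    have "\<bar>\<delta> i\<bar> \<le> (\<Sum>i\<in>F. \<bar>\<delta> i\<bar>)" using that F(1) by (intro member_le_sum) auto
    then have "\<bar>\<delta> i\<bar> \<le> D" unfolding D_def by simp
    then have "e * \<bar>\<delta> i\<bar> \<le> e * D" using e by simp
    also have "\<dots> = Min (\<tau> ` F)" using D by (simp add: e_def)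
    also have "\<dots> \<le> \<tau> i" using F(1) that by simp
    finally show ?thesis using e by (simp add: abs_mult)
  qed
  define zz where "zz t i = (if i \<in> F then (\<lambda>j. z i j + t * \<delta> i * d i j) else z i)" for t i
  have lin: "(\<Sum>i<N. rowdot (n i) (g i) (zz t i)) =
      (\<Sum>i<N. rowdot (n i) (g i) (z i)) + t * (\<Sum>i\<in>F. \<delta> i * rowdot (n i) (g i) (d i))" for g t
  proof -
    have "(\<Sum>i<N. rowdot (n i) (g i) (zz t i)) = (\<Sum>i<N. rowdot (n i) (g i) (z i)
        + (if i \<in> F then t * (\<delta> i * rowdot (n i) (g i) (d i)) else 0))"
      by (rule sum.cong) (auto simp: zz_def rowdot_dot dot_add)
    also have "\<dots> = (\<Sum>i<N. rowdot (n i) (g i) (z i))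
        + (\<Sum>i\<in>F. t * (\<delta> i * rowdot (n i) (g i) (d i)))"
      using F(2) by (simp add: sum.distrib sum.inter_restrict[symmetric] Int_absorb1)
    finally show ?thesis by (simp add: sum_distrib_left)
  qed
  define \<kappa> where "\<kappa> = (\<Sum>i\<in>F. \<delta> i * rowdot (n i) (c i) (d i))"
  have zzfeas: "LPr_feasible N S n A X b r (zz t)" if "\<bar>t\<bar> = e" for t
  proof -
    have "zz t i \<in> conv (X i)" if "i < N" for i
    proof (cases "i \<in> F")
      case True
      have "\<bar>t * \<delta> i\<bar> = \<bar>e * \<delta> i\<bar>" using \<open>\<bar>t\<bar> = e\<close> e by (simp add: abs_mult)
      then show ?thesis using d(3)[OF True] small[OF True] True by (simp add: zz_def)
    qed (use feas(1) that in \<open>simp add: zz_def\<close>)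
    then show ?thesis unfolding LPr_feasible_def lin using \<delta>(2) feas(2) by simp
  qed
  \<comment> \<open>Both displacements are feasible, so optimality forces the cost to be constant
    along the direction; the displaced tuple is then a second optimum, against uniqueness.\<close>
  have "0 \<le> e * \<kappa>" "0 \<le> - e * \<kappa>"
    using best[OF zzfeas[of e]] best[OF zzfeas[of "- e"]] e unfolding lin \<kappa>_def by auto
  then have "e * \<kappa> = 0" by simp
  then have \<kappa>: "\<kappa> = 0" using e by simp
  have "LPr_optimal N S n c A X b r (zz e)"
    unfolding LPr_optimal_def lin \<kappa>_def[symmetric] \<kappa> using zzfeas[of e] e best by simp
  then have eq: "\<forall>i<N. zz e i = z i" by (rule unique)
  obtain i where i: "i \<in> F" "\<delta> i \<noteq> 0" using \<delta>(1) by blast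
  obtain j where "d i j \<noteq> 0" using d(1)[OF i(1)] by blast
  then have "zz e i j \<noteq> z i j" using i e by (simp add: zz_def)
  moreover have "zz e i = z i" using eq i(1) F(2) by blast
  ultimately show False by simp
qed

text \<open>A real infimum is a lower bound only if the set is bounded below, which the finitely
  many generators ensure. By linearity of the row the bound passes from X to its hull, where the LP
  solution lives.\<close>

lemma Lbound_le:
  assumes X: "finitely_generated X" and z: "z \<in> conv X"
  shows "Lbound n A X s \<le> rowdot n (A s) z"
proof -
  obtain V where V: "finite V" "conv X = fin_hull V" using X unfolding finitely_generated_def by blast
  have row: "rowdot n g (\<lambda>j. \<Sum>p\<in>V. w p * p j) = (\<Sum>p\<in>V. w p * rowdot n g p)" for n g V w
    unfolding rowdot_dot by (rule dot_sum)
  have "- (\<Sum>p\<in>V. \<bar>rowdot n (A s) p\<bar>) \<le> rowdot n (A s) x" if x: "x \<in> conv X" for x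
  proof -
    obtain w where w: "weights V w" "x = (\<lambda>j. \<Sum>p\<in>V. w p * p j)"
      using x unfolding V(2) by (rule fin_hullE)
    have "w p * rowdot n (A s) p \<ge> - \<bar>rowdot n (A s) p\<bar>" if "p \<in> V" for p
    proof -
      have "w p \<le> sum w V" using w(1) V(1) that by (intro member_le_sum) (auto simp: weights_def)
      then have "w p \<le> 1" "w p \<ge> 0" using w(1) that by (auto simp: weights_def)
      then have "w p * \<bar>rowdot n (A s) p\<bar> \<le> 1 * \<bar>rowdot n (A s) p\<bar>" by (intro mult_right_mono) auto
      moreover have "\<bar>w p * rowdot n (A s) p\<bar> = w p * \<bar>rowdot n (A s) p\<bar>"
        using \<open>w p \<ge> 0\<close> by (simp add: abs_mult)
      ultimately show ?thesis by linarith
    qed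
    then have "(\<Sum>p\<in>V. - \<bar>rowdot n (A s) p\<bar>) \<le> (\<Sum>p\<in>V. w p * rowdot n (A s) p)"
      by (rule sum_mono)
    then show ?thesis unfolding w(2) row by (simp add: sum_negf)
  qed
  then have bdd: "bdd_below ((\<lambda>x. rowdot n (A s) x) ` X)"
    by (intro bdd_belowI2) (auto intro: conv_inc)
  have low: "Lbound n A X s \<le> rowdot n (A s) x" if "x \<in> X" for x
    unfolding Lbound_def using bdd that by (rule cINF_lower)
  obtain F where F: "finite F" "F \<subseteq> X" "z \<in> fin_hull F" using z unfolding conv_iff by auto
  obtain w where w: "weights F w" "z = (\<lambda>j. \<Sum>p\<in>F. w p * p j)" using F(3) by (rule fin_hullE)
  have "Lbound n A X s = (\<Sum>p\<in>F. w p * Lbound n A X s)"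
    using w(1) by (simp add: weights_def sum_distrib_right[symmetric])
  also have "\<dots> \<le> (\<Sum>p\<in>F. w p * rowdot n (A s) p)"
    using w(1) low F(2) by (intro sum_mono mult_left_mono) (auto simp: weights_def)
  finally show ?thesis unfolding w(2) row .
qed

section \<open>The limit allocation\<close>

lemma limit_allocation_sum:
  assumes graph: "connected_graph N Nb" and s: "s < S"
    and rec: "\<And>t i s. i < N \<Longrightarrow> s < S \<Longrightarrow>
        y (Suc t) i s = y t i s + \<alpha> t * (\<Sum>j\<in>Nb i. \<mu> t i s - \<mu> t j s)"
    and lim: "\<And>i s. i < N \<Longrightarrow> s < S \<Longrightarrow> (\<lambda>t. y t i s :: real) \<longlonglongrightarrow> yinf i s"
  shows "(\<Sum>i<N. y t i s) = (\<Sum>i<N. y 0 i s)" and "(\<Sum>i<N. yinf i s) = (\<Sum>i<N. y 0 i s)"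
proof -
  have const: "(\<Sum>i<N. y t i s) = (\<Sum>i<N. y 0 i s)" for t
  proof (induction t)
    case (Suc t)
    have "(\<Sum>i<N. y (Suc t) i s) = (\<Sum>i<N. y t i s + \<alpha> t * (\<Sum>j\<in>Nb i. \<mu> t i s - \<mu> t j s))"
      by (rule sum.cong) (simp_all only: lessThan_iff rec s)
    also have "\<dots> = (\<Sum>i<N. y t i s) + \<alpha> t * (\<Sum>i<N. \<Sum>j\<in>Nb i. \<mu> t i s - \<mu> t j s)"
      by (simp add: sum.distrib sum_distrib_left)
    finally show ?case using Suc laplacian_sum_zero[OF graph, of "\<lambda>i. \<mu> t i s"] by simp
  qed simp
  show "(\<Sum>i<N. y t i s) = (\<Sum>i<N. y 0 i s)" by (rule const)
  have "(\<lambda>t. \<Sum>i<N. y t i s) \<longlonglongrightarrow> (\<Sum>i<N. yinf i s)"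
    using lim s by (intro tendsto_sum) auto
  moreover have "(\<lambda>t. \<Sum>i<N. y t i s) = (\<lambda>_. \<Sum>i<N. y 0 i s)"
    using const by (rule ext)
  ultimately show "(\<Sum>i<N. yinf i s) = (\<Sum>i<N. y 0 i s)" by (simp add: LIMSEQ_const_iff)
qed

text \<open>Distributing the slack of an optimal solution zopt evenly turns it into an allocation ybar with
  the same total as yinf. The multipliers are subgradients of the local optimal values, so
  the total local cost at y t exceeds the optimum by at most their pairing with y t - ybar.\<close>

lemma limit_allocation_optimal:
  fixes S N :: nat and M K :: real
  assumes X: "\<And>i. i < N \<Longrightarrow> finitely_generated (X i)"
    and graph: "connected_graph N Nb" and N: "N \<ge> 1"
    and opt: "LPr_optimal N S n c A X b r zopt"
    and penalty: "\<And>z v. 0 \<le> v \<Longrightarrow> \<forall>i<N. z i \<in> conv (X i) \<Longrightarrow>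
     \<forall>s<S. (\<Sum>i<N. rowdot (n i) (A i s) (z i)) \<le> b s - r s + v \<Longrightarrow>
     (\<Sum>i<N. rowdot (n i) (c i) (zopt i)) \<le> (\<Sum>i<N. rowdot (n i) (c i) (z i)) + K * v"
    and M: "M \<ge> K + 1" "M > 0"
    and step: "assumption_B \<alpha>"
    and init: "\<And>s. s < S \<Longrightarrow> (\<Sum>i<N. y 0 i s) = b s - r s"
    and primal: "\<And>t i. i < N \<Longrightarrow> P1_primal_optimal S (n i) (c i) M (A i) (X i) (y t i) (z t i) (v t i)"
    and dual: "\<And>t i. i < N \<Longrightarrow> P1_dual_optimal S (n i) (c i) M (A i) (X i) (y t i) (\<mu> t i)"
    and rec: "\<And>t i s. i < N \<Longrightarrow> s < S \<Longrightarrow>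
        y (Suc t) i s = y t i s + \<alpha> t * (\<Sum>j\<in>Nb i. \<mu> t i s - \<mu> t j s)"
    and lim: "\<And>i s. i < N \<Longrightarrow> s < S \<Longrightarrow> (\<lambda>t. y t i s) \<longlonglongrightarrow> yinf i s"
  shows "\<exists>z. LPr_optimal N S n c A X b r z \<and> (\<forall>i<N. \<forall>s<S. rowdot (n i) (A i s) (z i) \<le> yinf i s)"
proof -
  define J where "J = (\<Sum>i<N. rowdot (n i) (c i) (zopt i))"
  have zopt: "\<And>i. i < N \<Longrightarrow> zopt i \<in> conv (X i)"
      "\<And>s. s < S \<Longrightarrow> (\<Sum>i<N. rowdot (n i) (A i s) (zopt i)) \<le> b s - r s"
    using opt unfolding LPr_optimal_def LPr_feasible_def by auto
  have ysum: "(\<Sum>i<N. y t i s) = b s - r s" "(\<Sum>i<N. yinf i s) = b s - r s" if "s < S" for s t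
    using limit_allocation_sum[OF graph that, of y \<alpha> \<mu> yinf] rec lim init[OF that] by auto
  have P1: "z t i \<in> conv (X i)" "v t i \<ge> 0" "\<And>s. s < S \<Longrightarrow> rowdot (n i) (A i s) (z t i) \<le> y t i s + v t i"
    if "i < N" for t i
    using primal[OF that, of t] unfolding P1_primal_optimal_def P1_feasible_def by auto
  have \<mu>0: "0 \<le> \<mu> t i s" if "i < N" "s < S" for t i s
    using P1_multiplier(1)[OF X[OF that(1)] primal dual] that by blast
  have \<mu>M: "\<mu> t i s \<le> M" if "i < N" "s < S" for t i s
  proof -
    have "\<mu> t i s \<le> (\<Sum>s<S. \<mu> t i s)" using \<mu>0 that by (intro member_le_sum) auto
    also have "\<dots> \<le> M" using P1_multiplier(2)[OF X[OF that(1)] primal dual] that by blast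
    finally show ?thesis .
  qed
  define slack where "slack s = b s - r s - (\<Sum>i<N. rowdot (n i) (A i s) (zopt i))" for s
  define ybar where "ybar i s = rowdot (n i) (A i s) (zopt i) + slack s / real N" for i s
  \<comment> \<open>A direction of zero total, from the comparison allocation to the limit, as
    \<open>multiplier_pairing\<close> demands.\<close>
  define h where "h i s = yinf i s - ybar i s" for i s
  have ybar_ge: "rowdot (n i) (A i s) (zopt i) \<le> ybar i s" if "s < S" for i s
    unfolding ybar_def slack_def using zopt(2)[OF that] by simp
  have h0: "(\<Sum>i<N. h i s) = 0" if "s < S" for s
    unfolding h_def ybar_def using ysum(2)[OF that] N by (simp add: sum.distrib sum_subtractf slack_def)
  define dev where "dev t = (\<Sum>i<N. \<Sum>s<S. \<bar>yinf i s - y t i s\<bar>)" for t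
  have dev_ge: "\<bar>yinf i s - y t i s\<bar> \<le> dev t" if "i < N" "s < S" for i s t
  proof -
    have "\<bar>yinf i s - y t i s\<bar> \<le> (\<Sum>s<S. \<bar>yinf i s - y t i s\<bar>)"
      using that by (intro member_le_sum[of s "{..<S}" "\<lambda>s. \<bar>yinf i s - y t i s\<bar>"]) auto
    also have "\<dots> \<le> dev t" unfolding dev_def
      using that by (intro member_le_sum[of i "{..<N}" "\<lambda>i. \<Sum>s<S. \<bar>yinf i s - y t i s\<bar>"] sum_nonneg) auto
    finally show ?thesis .
  qed
  have "dev \<longlonglongrightarrow> (\<Sum>i<N. \<Sum>s<S. \<bar>yinf i s - yinf i s\<bar>)"
    unfolding dev_def using lim by (intro tendsto_intros) auto
  then have dev: "dev \<longlonglongrightarrow> 0" by simp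
  have subgrad: "(\<Sum>i<N. rowdot (n i) (c i) (z t i) + M * v t i)
      \<le> J - (\<Sum>i<N. \<Sum>s<S. \<mu> t i s * h i s) + M * dev t" for t
  proof -
    have "(\<Sum>i<N. rowdot (n i) (c i) (z t i) + M * v t i)
        \<le> (\<Sum>i<N. rowdot (n i) (c i) (zopt i)
             + (\<Sum>s<S. \<mu> t i s * (rowdot (n i) (A i s) (zopt i) - y t i s)))"
    proof (rule sum_mono)
      fix i assume "i \<in> {..<N}"
      then have i: "i < N" by simp
      show "rowdot (n i) (c i) (z t i) + M * v t i \<le> rowdot (n i) (c i) (zopt i)
             + (\<Sum>s<S. \<mu> t i s * (rowdot (n i) (A i s) (zopt i) - y t i s))"
        by (rule P1_multiplier(3)[OF X[OF i] primal[OF i] dual[OF i] zopt(1)[OF i]])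
    qed
    also have "\<dots> = J + (\<Sum>i<N. \<Sum>s<S. \<mu> t i s * (rowdot (n i) (A i s) (zopt i) - y t i s))"
      by (simp add: J_def sum.distrib)
    also have "\<dots> \<le> J + (\<Sum>i<N. \<Sum>s<S. - (\<mu> t i s * h i s) + M * \<bar>yinf i s - y t i s\<bar>)"
    proof (intro add_left_mono sum_mono)
      fix i s assume "i \<in> {..<N}" "s \<in> {..<S}"
      then have ik: "i < N" "s < S" by auto
      have "\<mu> t i s * (rowdot (n i) (A i s) (zopt i) - y t i s) \<le> \<mu> t i s * (ybar i s - y t i s)"
        using \<mu>0[OF ik] ybar_ge[OF ik(2)] by (intro mult_left_mono) auto
      also have "\<dots> = - (\<mu> t i s * h i s) + \<mu> t i s * (yinf i s - y t i s)"
        by (simp add: h_def algebra_simps)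
      also have "\<mu> t i s * (yinf i s - y t i s) \<le> \<mu> t i s * \<bar>yinf i s - y t i s\<bar>"
        using \<mu>0[OF ik] by (intro mult_left_mono) auto
      also have "\<dots> \<le> M * \<bar>yinf i s - y t i s\<bar>"
        using \<mu>M[OF ik] by (intro mult_right_mono) auto
      finally show "\<mu> t i s * (rowdot (n i) (A i s) (zopt i) - y t i s)
          \<le> - (\<mu> t i s * h i s) + M * \<bar>yinf i s - y t i s\<bar>" by simp
    qed
    also have "\<dots> = J - (\<Sum>i<N. \<Sum>s<S. \<mu> t i s * h i s) + M * dev t"
      by (simp add: dev_def sum.distrib sum_subtractf sum_negf sum_distrib_left)
    finally show ?thesis .
  qed
  have near: "\<exists>x. (\<forall>i<N. x i \<in> conv (X i)) \<and> (\<Sum>i<N. rowdot (n i) (c i) (x i)) \<le> J + \<epsilon> \<and>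
      (\<forall>i<N. \<forall>s<S. rowdot (n i) (A i s) (x i) \<le> yinf i s + \<epsilon>)" if \<epsilon>: "\<epsilon> > 0" for \<epsilon>
  proof -
    \<comment> \<open>Chosen so that \<open>M * \<eta> + \<eta>\<close> equals half of \<epsilon>:
      one part pays for the deviation in the cost, the other for the deviation in the rows.\<close>
    define \<eta> where "\<eta> = \<epsilon> / (2 * (M + 1))"
    have \<eta>: "\<eta> > 0" "M * \<eta> \<le> \<epsilon> / 2 - \<eta>" using \<epsilon> M(2) by (auto simp: \<eta>_def field_simps)
    have M\<eta>: "M * \<eta> > 0" using \<eta>(1) M(2) by simp
    obtain T0 where T0: "\<And>t. t \<ge> T0 \<Longrightarrow> dev t < \<eta>"
      using order_tendstoD(2)[OF dev \<eta>(1)] unfolding eventually_sequentially by auto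
    have "\<exists>t\<ge>T0. - (\<epsilon> / 2) < (\<Sum>i<N. \<Sum>s<S. \<mu> t i s * h i s)"
    proof (rule multiplier_pairing[OF graph N])
      show "\<And>t. \<alpha> t \<ge> 0" "\<not> summable \<alpha>" using step by (auto simp: assumption_B_def)
      show "convergent (\<lambda>t. y t i s)" if "i < N" "s < S" for i s
        using lim[OF that] by (rule convergentI)
    qed (use rec h0 \<epsilon> in auto)
    then obtain t where t: "t \<ge> T0" "- (\<epsilon> / 2) < (\<Sum>i<N. \<Sum>s<S. \<mu> t i s * h i s)" by blast
    have "M * dev t \<le> M * \<eta>" using T0[OF t(1)] M(2) by simp
    then have cost: "(\<Sum>i<N. rowdot (n i) (c i) (z t i) + M * v t i) \<le> J + (\<epsilon> - \<eta>)"
      using subgrad[of t] t(2) \<eta>(2) by linarith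
    define W where "W = (\<Sum>i<N. v t i)"
    have vW: "v t i \<le> W" if "i < N" for i
      unfolding W_def using P1(2) that by (intro member_le_sum) auto
    have W0: "W \<ge> 0" unfolding W_def using P1(2) by (intro sum_nonneg) auto
    have cost': "(\<Sum>i<N. rowdot (n i) (c i) (z t i)) + M * W \<le> J + (\<epsilon> - \<eta>)"
      using cost by (simp add: W_def sum.distrib sum_distrib_left)
    \<comment> \<open>A total violation W saves at most \<open>K * W\<close> but costs
      \<open>M * W\<close>. The surplus of at least W must fit into the error
      \<open>\<epsilon> - \<eta>\<close>.\<close>
    have "J \<le> (\<Sum>i<N. rowdot (n i) (c i) (z t i)) + K * W"
      unfolding J_def
    proof (rule penalty[OF W0])
      show "\<forall>i<N. z t i \<in> conv (X i)" using P1(1) by blast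
      show "\<forall>s<S. (\<Sum>i<N. rowdot (n i) (A i s) (z t i)) \<le> b s - r s + W"
      proof (intro allI impI)
        fix s assume s: "s < S"
        have "(\<Sum>i<N. rowdot (n i) (A i s) (z t i)) \<le> (\<Sum>i<N. y t i s + v t i)"
          using P1(3) s by (intro sum_mono) auto
        also have "\<dots> = b s - r s + W" using ysum(1)[OF s] by (simp add: sum.distrib W_def)
        finally show "(\<Sum>i<N. rowdot (n i) (A i s) (z t i)) \<le> b s - r s + W" .
      qed
    qed
    moreover have "(K + 1) * W \<le> M * W" using M(1) W0 by (rule mult_right_mono)
    ultimately have W: "W \<le> \<epsilon> - \<eta>" using cost' by (simp add: distrib_right)
    have "(\<Sum>i<N. rowdot (n i) (c i) (z t i)) \<le> J + \<epsilon>"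
      using cost' mult_nonneg_nonneg[of M W] W0 M(2) \<eta>(1) by linarith
    moreover have "rowdot (n i) (A i s) (z t i) \<le> yinf i s + \<epsilon>" if "i < N" "s < S" for i s
      using P1(3)[OF that, of t] dev_ge[OF that, of t] T0[OF t(1)] vW[OF that(1)] W by linarith
    ultimately show ?thesis using P1(1) by (intro exI[of _ "z t"]) auto
  qed
  \<comment> \<open>One system of constraints: \<open>None\<close> bounds the total cost by the
    optimum, and \<open>Some (i, s)\<close> is row s of agent i, with zero coefficients for all
    other agents.\<close>
  define E where "E = insert None (Some ` ({..<N} \<times> {..<S}))"
  define a where "a e k = (case e of None \<Rightarrow> c k | Some (i, s) \<Rightarrow> if k = i then A i s else (\<lambda>_. 0))" for e k
  define B where "B e = (case e of None \<Rightarrow> J | Some (i, s) \<Rightarrow> yinf i s)" for e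
  have aNone: "(\<Sum>k<N. rowdot (n k) (a None k) (x k)) = (\<Sum>k<N. rowdot (n k) (c k) (x k))" for x
    by (simp add: a_def)
  have aSome: "(\<Sum>k<N. rowdot (n k) (a (Some (i, s)) k) (x k)) = rowdot (n i) (A i s) (x i)"
    if "i < N" for i s x
  proof -
    have "(\<Sum>k<N. rowdot (n k) (a (Some (i, s)) k) (x k)) =
        (\<Sum>k<N. if k = i then rowdot (n i) (A i s) (x i) else 0)"
      by (rule sum.cong) (auto simp: a_def rowdot_def)
    then show ?thesis using that by simp
  qed
  have "\<exists>x. (\<forall>i\<in>{..<N}. x i \<in> conv (X i)) \<and>
      (\<forall>e\<in>E. (\<Sum>k\<in>{..<N}. rowdot (n k) (a e k) (x k)) \<le> B e)"
  proof (rule feasible_if_nearly_feasible)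
    fix \<epsilon> :: real assume "\<epsilon> > 0"
    then obtain x where x: "\<forall>i<N. x i \<in> conv (X i)" "(\<Sum>i<N. rowdot (n i) (c i) (x i)) \<le> J + \<epsilon>"
      "\<forall>i<N. \<forall>s<S. rowdot (n i) (A i s) (x i) \<le> yinf i s + \<epsilon>" using near by blast
    show "\<exists>x. (\<forall>i\<in>{..<N}. x i \<in> conv (X i)) \<and>
        (\<forall>e\<in>E. (\<Sum>k\<in>{..<N}. rowdot (n k) (a e k) (x k)) \<le> B e + \<epsilon>)"
      using x by (intro exI[of _ x]) (auto simp: E_def aNone aSome B_def)
  qed (use X in \<open>auto simp: E_def\<close>)
  then obtain x where x: "\<forall>i<N. x i \<in> conv (X i)"
      "\<And>e. e \<in> E \<Longrightarrow> (\<Sum>k<N. rowdot (n k) (a e k) (x k)) \<le> B e" by auto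
  have xc: "(\<Sum>i<N. rowdot (n i) (c i) (x i)) \<le> J"
    using x(2)[of None] by (simp add: E_def aNone B_def)
  have xA: "rowdot (n i) (A i s) (x i) \<le> yinf i s" if "i < N" "s < S" for i s
    using x(2)[of "Some (i, s)"] that by (auto simp: E_def aSome B_def)
  have "LPr_feasible N S n A X b r x"
    unfolding LPr_feasible_def
  proof (intro conjI allI impI)
    fix s assume s: "s < S"
    have "(\<Sum>i<N. rowdot (n i) (A i s) (x i)) \<le> (\<Sum>i<N. yinf i s)"
      using xA s by (intro sum_mono) auto
    then show "(\<Sum>i<N. rowdot (n i) (A i s) (x i)) \<le> b s - r s" using ysum(2)[OF s] by simp
  qed (use x in auto)
  then have "LPr_optimal N S n c A X b r x"
    using opt xc unfolding LPr_optimal_def J_def by (meson order_trans)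
  then show ?thesis using xA by blast
qed

section \<open>Feasibility of the limit mixed-integer solution\<close>

lemma P3_violation_le:
  assumes lex: "P3_lex_optimal S n c A X y \<rho> \<xi> x"
    and x': "x' \<in> X" "q \<ge> 0" "\<And>s. s < S \<Longrightarrow> rowdot n (A s) x' \<le> y s + q"
  shows "\<rho> \<le> q"
proof -
  have "P3_feasible S n c A X y q (rowdot n c x') x'"
    using x' unfolding P3_feasible_def by auto
  then have "\<rho> < q \<or> (\<rho> = q \<and> \<xi> \<le> rowdot n c x')" using lex unfolding P3_lex_optimal_def by blast
  then show ?thesis by auto
qed

text \<open>An agent with \<open>z i\<close> in \<open>X i\<close> can use this point without
  violation. For any other agent each row of \<open>xL i\<close> is within q of the minimum of that
  row, and this minimum bounds the row of \<open>z i\<close> from below, so \<open>xL i\<close>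
  violates the allocation by at most q.\<close>

lemma lex_optimal_feasible:
  fixes S N :: nat
  assumes S: "S \<ge> 1"
    and X: "\<And>i. i < N \<Longrightarrow> finitely_generated (X i)"
    and xL: "\<And>i. i < N \<Longrightarrow> xL i \<in> X i"
    and \<sigma>: "\<sigma> = sigma_ASY N S n A X xL"
    and z: "\<And>i. i < N \<Longrightarrow> z i \<in> conv (X i)"
    and zy: "\<And>i s. i < N \<Longrightarrow> s < S \<Longrightarrow> rowdot (n i) (A i s) (z i) \<le> y i s"
    and frac: "card {i. i < N \<and> z i \<notin> X i} \<le> S"
    and ysum: "\<And>s. s < S \<Longrightarrow> (\<Sum>i<N. y i s) = b s - \<sigma>"
    and lex: "\<And>i. i < N \<Longrightarrow> P3_lex_optimal S (n i) (c i) (A i) (X i) (y i) (\<rho> i) (\<xi> i) (x i)"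
    and N: "N \<ge> 1" and s: "s < S"
  shows "(\<Sum>i<N. rowdot (n i) (A i s) (x i)) \<le> b s"
proof -
  let ?F = "{i. i < N \<and> z i \<notin> X i}"
  define G where "G = (\<lambda>(i, s). rowdot (n i) (A i s) (xL i) - Lbound (n i) (A i) (X i) s) ` ({..<N} \<times> {..<S})"
  define q where "q = Max G"
  have \<sigma>q: "\<sigma> = (real S + 1) * q" unfolding \<sigma> sigma_ASY_def q_def G_def by simp
  have Gq: "rowdot (n i) (A i s) (xL i) - Lbound (n i) (A i) (X i) s \<le> q" if "i < N" "s < S" for i s
  proof -
    have "finite G" unfolding G_def by simp
    moreover have "rowdot (n i) (A i s) (xL i) - Lbound (n i) (A i) (X i) s \<in> G"
      unfolding G_def by (rule image_eqI[of _ _ "(i, s)"]) (use that in auto)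
    ultimately show ?thesis unfolding q_def by (rule Max_ge)
  qed
  have q0: "q \<ge> 0"
    using Gq[of 0 0] Lbound_le[OF X[of 0] conv_inc[OF xL[of 0]], of "n 0" "A 0" 0] N S by simp
  have xfeas: "rowdot (n i) (A i s) (x i) \<le> y i s + \<rho> i" if "i < N" for i
    using lex[OF that] s unfolding P3_lex_optimal_def P3_feasible_def by blast
  have \<rho>: "\<rho> i \<le> (if i \<in> ?F then q else 0)" if i: "i < N" for i
  proof (cases "i \<in> ?F")
    case True
    have "rowdot (n i) (A i s) (xL i) \<le> y i s + q" if "s < S" for s
      using Gq[OF i that] Lbound_le[OF X[OF i] z[OF i], of "n i" "A i" s] zy[OF i that] by linarith
    then show ?thesis using P3_violation_le[OF lex[OF i] xL[OF i] q0] True by simp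
  next
    case False
    then have "z i \<in> X i" using i by simp
    then have "\<rho> i \<le> 0" using zy[OF i] by (intro P3_violation_le[OF lex[OF i]]) auto
    then show ?thesis using False by (simp only: if_False)
  qed
  have "(\<Sum>i<N. rowdot (n i) (A i s) (x i)) \<le> (\<Sum>i<N. y i s + (if i \<in> ?F then q else 0))"
  proof (rule sum_mono)
    fix i assume "i \<in> {..<N}"
    then show "rowdot (n i) (A i s) (x i) \<le> y i s + (if i \<in> ?F then q else 0)"
      using xfeas[of i] \<rho>[of i] by force
  qed
  also have "\<dots> = b s - \<sigma> + (\<Sum>i\<in>{..<N} \<inter> ?F. q)"
    using ysum[OF s] by (simp only: sum.distrib sum.inter_restrict[OF finite_lessThan])
  also have "{..<N} \<inter> ?F = ?F" by auto
  also have "(\<Sum>i\<in>?F. q) = real (card ?F) * q" by simp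
  also have "\<dots> \<le> real S * q" using frac q0 by (intro mult_right_mono) auto
  finally show ?thesis using q0 unfolding \<sigma>q by (simp add: distrib_right)
qed

theorem theorem1:
  fixes N S :: nat
    and n Zc m :: "nat \<Rightarrow> nat"
    and D :: "nat \<Rightarrow> nat \<Rightarrow> nat \<Rightarrow> real" and d :: "nat \<Rightarrow> nat \<Rightarrow> real"
    and c :: "nat \<Rightarrow> nat \<Rightarrow> real" and A :: "nat \<Rightarrow> nat \<Rightarrow> nat \<Rightarrow> real"
    and b :: "nat \<Rightarrow> real"
    and Nb :: "nat \<Rightarrow> nat set"
    and xL :: "nat \<Rightarrow> nat \<Rightarrow> real" and lv :: "nat \<Rightarrow> real"
  defines "X \<equiv> (\<lambda>i. milp_set (n i) (Zc i) (m i) (D i) (d i))"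
  assumes N_pos: "N \<ge> 1" and S_pos: "S \<ge> 1"
    and Zc_le: "\<forall>i<N. Zc i \<le> n i"
    and X_nonempty: "\<forall>i<N. X i \<noteq> {}"
    and X_compact: "\<forall>i<N. compact (X i)"
    and milp_feasible: "\<exists>x. (\<forall>i<N. x i \<in> X i) \<and>
                         (\<forall>s<S. (\<Sum>i<N. rowdot (n i) (A i s) (x i)) \<le> b s)"
    and graph: "connected_graph N Nb"
    and xL_opt: "\<forall>i<N. xL_optimal S (n i) (A i) (X i) (xL i) (lv i)"
    and assmA: "assumption_A N S n c A X b (\<lambda>s. sigma_ASY N S n A X xL)"
  shows "\<exists>M0. \<forall>M\<ge>M0. M > 0 \<longrightarrow>
    (\<forall>(\<alpha>::nat \<Rightarrow> real) (y::nat \<Rightarrow> nat \<Rightarrow> nat \<Rightarrow> real) (z::nat \<Rightarrow> nat \<Rightarrow> nat \<Rightarrow> real)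
       (v::nat \<Rightarrow> nat \<Rightarrow> real) (\<mu>::nat \<Rightarrow> nat \<Rightarrow> nat \<Rightarrow> real)
       (yinf::nat \<Rightarrow> nat \<Rightarrow> real) (\<rho>::nat \<Rightarrow> real) (\<xi>::nat \<Rightarrow> real) (xinf::nat \<Rightarrow> nat \<Rightarrow> real).
      assumption_B \<alpha>
      \<and> (\<forall>s<S. (\<Sum>i<N. y 0 i s) = b s - sigma_ASY N S n A X xL)
      \<and> (\<forall>t. \<forall>i<N. P1_primal_optimal S (n i) (c i) M (A i) (X i) (y t i) (z t i) (v t i)
                   \<and> P1_dual_optimal S (n i) (c i) M (A i) (X i) (y t i) (\<mu> t i))
      \<and> (\<forall>t. \<forall>i<N. \<forall>s<S. y (Suc t) i s = y t i s + \<alpha> t * (\<Sum>j\<in>Nb i. \<mu> t i s - \<mu> t j s))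
      \<and> (\<forall>i<N. \<forall>s<S. (\<lambda>t. y t i s) \<longlonglongrightarrow> yinf i s)
      \<and> (\<forall>i<N. P3_lex_optimal S (n i) (c i) (A i) (X i) (yinf i) (\<rho> i) (\<xi> i) (xinf i))
      \<longrightarrow> (\<forall>i<N. xinf i \<in> X i) \<and>
          (\<forall>s<S. (\<Sum>i<N. rowdot (n i) (A i s) (xinf i)) \<le> b s))"
proof -
  let ?r = "\<lambda>s. sigma_ASY N S n A X xL"
  have fg: "finitely_generated (X i)" if "i < N" for i
    using that Zc_le X_compact unfolding X_def by (auto intro: milp_set_finitely_generated)
  obtain zopt where opt: "LPr_optimal N S n c A X b ?r zopt"
    using assmA unfolding assumption_A_def by blast
  have unique: "\<forall>i<N. z' i = z i"
    if "LPr_optimal N S n c A X b ?r z" "LPr_optimal N S n c A X b ?r z'" for z z'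
    using assmA that unfolding assumption_A_def by blast
  obtain K where penalty: "\<And>z v. 0 \<le> v \<Longrightarrow> \<forall>i<N. z i \<in> conv (X i) \<Longrightarrow>
     \<forall>s<S. (\<Sum>i<N. rowdot (n i) (A i s) (z i)) \<le> b s - ?r s + v \<Longrightarrow>
     (\<Sum>i<N. rowdot (n i) (c i) (zopt i)) \<le> (\<Sum>i<N. rowdot (n i) (c i) (z i)) + K * v"
    using LPr_exact_penalty[of N X S n c A b ?r zopt, OF fg opt] by auto
  show ?thesis
  \<comment> \<open>The excess 1 over the penalty constant is what bounds the total violation in the
    run, instead of merely making it free of gain.\<close>
  proof (intro exI[of _ "K + 1"] allI impI, elim conjE)
    fix M \<alpha> y z v \<mu> yinf \<rho> \<xi> xinf
    assume M: "K + 1 \<le> M" "0 < M" and step: "assumption_B \<alpha>"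
      and init: "\<forall>s<S. (\<Sum>i<N. y 0 i s) = b s - sigma_ASY N S n A X xL"
      and P1: "\<forall>t. \<forall>i<N. P1_primal_optimal S (n i) (c i) M (A i) (X i) (y t i) (z t i) (v t i)
                   \<and> P1_dual_optimal S (n i) (c i) M (A i) (X i) (y t i) (\<mu> t i)"
      and rec: "\<forall>t. \<forall>i<N. \<forall>s<S. y (Suc t) i s = y t i s + \<alpha> t * (\<Sum>j\<in>Nb i. \<mu> t i s - \<mu> t j s)"
      and lim: "\<forall>i<N. \<forall>s<S. (\<lambda>t. y t i s) \<longlonglongrightarrow> yinf i s"
      and lex: "\<forall>i<N. P3_lex_optimal S (n i) (c i) (A i) (X i) (yinf i) (\<rho> i) (\<xi> i) (xinf i)"
    have "\<exists>z. LPr_optimal N S n c A X b ?r z \<and> (\<forall>i<N. \<forall>s<S. rowdot (n i) (A i s) (z i) \<le> yinf i s)"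
      by (rule limit_allocation_optimal[where z = z and v = v and \<mu> = \<mu> and y = y,
            OF fg graph N_pos opt penalty M step])
        (use init P1 rec lim in auto)
    then obtain x where x: "LPr_optimal N S n c A X b ?r x"
        "\<forall>i<N. \<forall>s<S. rowdot (n i) (A i s) (x i) \<le> yinf i s" by blast
    have frac: "card {i. i < N \<and> x i \<notin> X i} \<le> S"
      using x(1) unique[OF x(1)] by (rule card_fractional_le)
    have ysum: "(\<Sum>i<N. yinf i s) = b s - sigma_ASY N S n A X xL" if "s < S" for s
      using limit_allocation_sum(2)[OF graph that, of y \<alpha> \<mu> yinf] rec lim init that by auto
    have "(\<Sum>i<N. rowdot (n i) (A i s) (xinf i)) \<le> b s" if "s < S" for s
    proof (rule lex_optimal_feasible[OF S_pos fg _ refl _ _ frac ysum _ N_pos that])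
      show "xL i \<in> X i" if "i < N" for i using xL_opt that by (simp add: xL_optimal_def)
      show "x i \<in> conv (X i)" if "i < N" for i
        using x(1) that by (simp add: LPr_optimal_def LPr_feasible_def)
    qed (use x(2) lex in auto)
    moreover have "\<forall>i<N. xinf i \<in> X i"
      using lex unfolding P3_lex_optimal_def P3_feasible_def by blast
    ultimately show "(\<forall>i<N. xinf i \<in> X i) \<and>
          (\<forall>s<S. (\<Sum>i<N. rowdot (n i) (A i s) (xinf i)) \<le> b s)" by blast
  qed
qed

end
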